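(* Let $F:\mathbb{T}\times\mathbb{R}^N\to\mathbb{R}^N$ satisfy, for some constant $\mathcal{L}>0$, $\|F(t,x)-F(t,y)\|\le \mathcal{L}\|x-y\|$ for all $t\in\mathbb{T}$ and $x,y\in\mathbb{R}^N$. Suppose that for all $i=1,\dots,N$: $\gamma(t)\lambda_i\in(0,\infty)$ for all $t\in\mathbb{T}$, and $0<\delta\le \mu(t)\gamma(t)\lambda_i<1$ for all $t\in\mathbb{T}^s$, where $\delta$ is a constant. Let $\mathcal{M}\in(0,1)$ be the associated decay constant (defined in the context). Suppose there is a constant $\mu^*>0$ with $\mu(t)\le\mu^*$ for all $t\in\mathbb{T}$, and that $$\lim_{t\to\infty} e^{\mathcal{L}\mathcal{M}^{-1}\sum_{j=1}^{i}(T_{2j}-T_{2j-1})}\,\mathcal{M}^{\sum_{j=1}^{i}\int_{T_{2j-1}}^{T_{2j}}|\gamma(s)|\,ds}\prod_{s\in[T_0,t)\cap\mathbb{T}^s}(\mathcal{M}+\mu^*\mathcal{L})=0,$$ where $t$ runs through the intervals $[T_{2i},T_{2i+1})$, $i\in\mathbb{N}_0$ (so $i$ is the index with $t\in[T_{2i},T_{2i+1})$), and $$\lim_{t\to\infty} e^{\mathcal{L}\mathcal{M}^{-1}\left(\sum_{j=1}^{i}(T_{2j}-T_{2j-1})+(t-T_{2i+1})\right)}\,\mathcal{M}^{\sum_{j=1}^{i}\int_{T_{2j-1}}^{T_{2j}}|\gamma(s)|\,ds+\int_{T_{2i+1}}^{t}|\gamma(s)|\,ds}\prod_{s\in[T_0,T_{2i+1})\cap\mathbb{T}^s}(\mathcal{M}+\mu^*\mathcal{L})=0,$$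 where $t$ runs through the intervals $[T_{2i+1},T_{2i+2})$, $i\in\mathbb{N}_0$. Then the equation $$(x-x_0\mathbf{1})^\Delta(t)=F(t,x(t))-F(t,x_0(t)\mathbf{1})-\gamma(t)B\,(x(t)-x_0(t)\mathbf{1})$$ is exponentially stable.
   Context: Time scale. $\mathbb{T}$ is a time scale (nonempty closed subset of $\mathbb{R}$) with $\inf\mathbb{T}=T_0\ge 0$ and $\sup\mathbb{T}=\infty$; $\sigma$ is the forward jump operator, $\mu(t)=\sigma(t)-t$ the graininess, ${}^\Delta$ the delta derivative. $\mathbb{T}^s$ and $\mathbb{T}^d$ are the sets of right-scattered and right-dense points. All intervals are intervals in $\mathbb{T}$. $\mathbb{N}_0=\{0,1,2,\dots\}$. Points $T_j$. Put $T_1=\min\{t\in[T_0,\infty)\cap\mathbb{T}^d:[T_0,t)\subset\mathbb{T}^s\}$ and, for $i\ge1$, $T_{2i}=\inf\{t\in[T_{2i-1},\infty)\cap\mathbb{T}^s:[T_{2i-1},t)\subset\mathbb{T}^d\}$, $T_{2i+1}=\min\{t\in[T_{2i},\infty)\cap\mathbb{T}^d:[T_{2i},t)\subset\mathbb{T}^s\}$. If $[T_{2i-1},\infty)\cap\mathbb{T}^s=\emptyset$, or if $[T_{2i-1},t)\cap\mathbb{T}^d=[T_{2i-1},T_{2i-1})=\emptyset$, then $T_{2i}=\infty$; if $[T_{2i},\infty)\cap\mathbb{T}^d=\emptyset$ then $T_{2i+1}=\infty$. Once $T_j=\infty$, all later $T_{j+k}=\infty$ and the corresponding intervals are empty. The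 time scale is written as $\mathbb{T}=\{T_0\}\cup\bigcup_{i\ge0}\big((T_{2i},T_{2i+1}]\cup(T_{2i+1},T_{2i+2}]\big)$ with $(T_{2i},T_{2i+1})\subset\mathbb{T}^s$ and $(T_{2i+1},T_{2i+2})\subset\mathbb{T}^d$. System. $x_0:\mathbb{T}\to\mathbb{R}$ is the given leader trajectory, $x:\mathbb{T}\to\mathbb{R}^N$ the unknown state of the $N$ agents with $x(T_0)=x_{T_0}$, $\mathbf{1}=(1,\dots,1)^T\in\mathbb{R}^N$, $\gamma:\mathbb{T}\to\mathbb{R}$ the feedback gain, $B$ a real symmetric $N\times N$ matrix with eigenvalues $\lambda_1,\dots,\lambda_N$. Write $\varepsilon(t)=x(t)-x_0(t)\mathbf{1}$, $\varepsilon_{T_0}=\varepsilon(T_0)$. $\|\cdot\|$ is the Euclidean norm of vectors and the spectral norm of matrices. $-\gamma B$ is regressive ($I-\mu(t)\gamma(t)B$ invertible for all $t$) and the data are regular enough (rd-continuous) for exponentials and integrals to be defined; $e_{-\gamma B}(t,s)$ is the matrix solution of $X^\Delta(t)=-\gamma(t)BX(t)$, $X(s)=I$. Decay constant. $\mathcal{M}\in(0,1)$ is a constant such that for all $i\in\mathbb{N}_0$: $\|e_{-\gamma B}(t,T_{2i})\|\le\prod_{s\in[T_{2i},t)}\mathcal{M}$ for $t\in[T_{2i},T_{2i+1})$, and $\|e_{-\gamma B}(t,T_{2i+1})\|\le\mathcal{M}^{\int_{T_{2i+1}}^t|\gamma(s)|ds}$ for $t\in[T_{2i+1},T_{2i+2})$.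 (The existence of such an $\mathcal{M}$ under the stated hypotheses on $\gamma\lambda_i$ is a lemma of the paper.) Exponential stability. The equation is exponentially stable if there exist positive constants $c,d$ such that every rd-continuous solution satisfies $\lim_{t\to\infty}\|\varepsilon(t)\|\le c\,\|\varepsilon_{T_0}\|\lim_{t\to\infty}e_{\ominus d}(t,T_0)=0$, where $e_{\ominus d}(t,T_0)=1/e_d(t,T_0)$ and $e_d(\cdot,T_0)$ is the solution of $y^\Delta=d\,y$, $y(T_0)=1$.
   Formalization: On the right-scattered intervals the decay bound for M is required from every starting point s in [T_{2i},T_{2i+1}] and up to T_{2i+1} itself, not only from T_{2i} for t<T_{2i+1}; with the bound as originally stated the claim is false. *)

theory Defs
  imports "HOL-Analysis.Analysis"
begin

section \<open>Time scale calculus\<close>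

text \<open>Functions on a time scale \<open>T\<close> are total functions on the reals whose values
  off \<open>T\<close> are never used. All time scales here are unbounded above, so \<open>Inf\<close> in
  \<open>sigma\<close> is never taken over the empty set and the delta derivative makes sense
  at every point of \<open>T\<close>.\<close>

definition time_scale :: "real set \<Rightarrow> bool" where
  "time_scale T \<longleftrightarrow> closed T \<and> T \<noteq> {}"

definition sigma :: "real set \<Rightarrow> real \<Rightarrow> real" where
  "sigma T t = Inf {s \<in> T. t < s}"

definition graininess :: "real set \<Rightarrow> real \<Rightarrow> real" where
  "graininess T t = sigma T t - t"

definition right_scattered :: "real set \<Rightarrow> real set" where
  "right_scattered T = {t \<in> T. sigma T t > t}"

definition right_dense :: "real set \<Rightarrow> real set" where
  "right_dense T = {t \<in> T. sigma T t = t}"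

definition left_dense :: "real set \<Rightarrow> real set" where
  "left_dense T = {t \<in> T. (\<exists>s\<in>T. s < t) \<and> Sup {s \<in> T. s < t} = t}"

definition rd_continuous :: "real set \<Rightarrow> (real \<Rightarrow> 'a::topological_space) \<Rightarrow> bool" where
  "rd_continuous T f \<longleftrightarrow>
     (\<forall>t\<in>right_dense T. (f \<longlongrightarrow> f t) (at t within T)) \<and>
     (\<forall>t\<in>left_dense T. \<exists>l. (f \<longlongrightarrow> l) (at t within {s \<in> T. s < t}))"

definition has_delta_derivative ::
  "real set \<Rightarrow> (real \<Rightarrow> 'a::real_normed_vector) \<Rightarrow> 'a \<Rightarrow> real \<Rightarrow> bool" where
  "has_delta_derivative T f D t \<longleftrightarrow>
     (\<forall>e>0. \<exists>r>0. \<forall>s\<in>T. \<bar>s - t\<bar> < r \<longrightarrow>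
        norm (f (sigma T t) - f s - (sigma T t - s) *\<^sub>R D) \<le> e * \<bar>sigma T t - s\<bar>)"

definition is_scalar_exponential :: "real set \<Rightarrow> real \<Rightarrow> real \<Rightarrow> (real \<Rightarrow> real) \<Rightarrow> bool" where
  "is_scalar_exponential T p s y \<longleftrightarrow>
     y s = 1 \<and> (\<forall>t\<in>T. has_delta_derivative T y (p * y t) t)"

definition is_matrix_exponential ::
  "real set \<Rightarrow> (real \<Rightarrow> real^'n^'n) \<Rightarrow> (real \<Rightarrow> real \<Rightarrow> real^'n^'n) \<Rightarrow> bool" where
  "is_matrix_exponential T A E \<longleftrightarrow>
     (\<forall>s\<in>T. E s s = mat 1 \<and> (\<forall>t\<in>T. has_delta_derivative T (\<lambda>r. E r s) (A t ** E t s) t))"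

section \<open>The points \<open>T\<^sub>j\<close>\<close>

text \<open>Each set below has at most one element, so minimum and infimum agree, and the
  infimum of the empty set is infinity in the extended reals; in particular all points
  after an infinite one are infinite.\<close>

primrec switch_point :: "real set \<Rightarrow> nat \<Rightarrow> ereal" where
  "switch_point T 0 = ereal (Inf T)"
| "switch_point T (Suc j) =
     (if even j
      then Inf {ereal t | t. t \<in> right_dense T \<and> switch_point T j \<le> ereal t \<and>
                  {s \<in> T. switch_point T j \<le> ereal s \<and> s < t} \<subseteq> right_scattered T}
      else Inf {ereal t | t. t \<in> right_scattered T \<and> switch_point T j \<le> ereal t \<and>
                  {s \<in> T. switch_point T j \<le> ereal s \<and> s < t} \<subseteq> right_dense T})"

abbreviation switch_real :: "real set \<Rightarrow> nat \<Rightarrow> real" where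
  "switch_real T j \<equiv> real_of_ereal (switch_point T j)"

definition piece :: "real set \<Rightarrow> nat \<Rightarrow> real set" where
  "piece T j = {t \<in> T. switch_point T j \<le> ereal t \<and> ereal t < switch_point T (Suc j)}"

text \<open>The filter for \<open>t \<rightarrow> \<infinity>\<close> with \<open>t\<close> running through the pieces number
  \<open>k i\<close>, where \<open>i\<close> is the index of the piece containing \<open>t\<close>.\<close>

definition at_top_pieces :: "real set \<Rightarrow> (nat \<Rightarrow> nat) \<Rightarrow> (nat \<times> real) filter" where
  "at_top_pieces T k = inf (filtercomap snd at_top) (principal {(i, t). t \<in> piece T (k i)})"

section \<open>Eigenvalues, norms and the decay constant\<close>

text \<open>The eigenvalues listed with multiplicity, through the characteristic polynomial
  (\<open>mat z\<close> is \<open>z\<close> times the identity).\<close>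

definition eigenvalue_list :: "real^'n^'n \<Rightarrow> ('n \<Rightarrow> real) \<Rightarrow> bool" where
  "eigenvalue_list B lam \<longleftrightarrow> (\<forall>z. det (mat z - B) = (\<Prod>i\<in>UNIV. z - lam i))"

definition spectral_norm :: "real^'n^'n \<Rightarrow> real" where
  "spectral_norm A = onorm (\<lambda>v. A *v v)"

text \<open>On the right-scattered pieces the estimate is required from every starting point
  \<open>s\<close> and up to the right end point of the piece. With \<open>s\<close> restricted to the left end
  point, or without the right end point, the estimate says nothing about the size of
  the individual jumps \<open>E (sigma T s) s\<close>, and stability can fail: for
  \<open>T = {0, 1, 2, \<dots>}\<close> take \<open>N = 1\<close>, \<open>B = 1\<close>, \<open>F t x = 0.85 * x\<close>, \<open>M = 0.1\<close> and
  \<open>\<gamma>\<close> alternating between \<open>0.99\<close> and \<open>0.01\<close>; for \<open>T\<close> the union of all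
  \<open>[2 * k, 2 * k + 1]\<close> take \<open>\<gamma> = 0.01\<close>, \<open>F t x = 0.1 * x\<close>, \<open>M = exp (- 1)\<close>.\<close>

definition decay_constant ::
  "real set \<Rightarrow> (real \<Rightarrow> real) \<Rightarrow> (real \<Rightarrow> real \<Rightarrow> real^'n^'n) \<Rightarrow> real \<Rightarrow> bool" where
  "decay_constant T \<gamma> E M \<longleftrightarrow> 0 < M \<and> M < 1 \<and>
     (\<forall>i. \<forall>s\<in>T. \<forall>t\<in>T.
        switch_point T (2 * i) \<le> ereal s \<and> s \<le> t \<and> ereal t \<le> switch_point T (2 * i + 1) \<longrightarrow>
        spectral_norm (E t s) \<le> (\<Prod>r\<in>{r \<in> T. s \<le> r \<and> r < t}. M)) \<and>
     (\<forall>i. \<forall>t\<in>piece T (2 * i + 1).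
        spectral_norm (E t (switch_real T (2 * i + 1)))
          \<le> M powr integral {switch_real T (2 * i + 1)..t} (\<lambda>s. \<bar>\<gamma> s\<bar>))"

section \<open>Leader-following system\<close>

text \<open>The numeral \<open>1\<close> of type \<open>real^'n\<close> is the all-ones vector.\<close>

definition tracking_error :: "(real \<Rightarrow> real^'n) \<Rightarrow> (real \<Rightarrow> real) \<Rightarrow> real \<Rightarrow> real^'n" where
  "tracking_error x x0 t = x t - x0 t *\<^sub>R 1"

definition is_solution ::
  "real set \<Rightarrow> (real \<Rightarrow> real^'n \<Rightarrow> real^'n) \<Rightarrow> (real \<Rightarrow> real) \<Rightarrow> real^'n^'n \<Rightarrow>
   (real \<Rightarrow> real) \<Rightarrow> (real \<Rightarrow> real^'n) \<Rightarrow> bool" where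
  "is_solution T F \<gamma> B x0 x \<longleftrightarrow>
     (\<forall>t\<in>T. has_delta_derivative T (tracking_error x x0)
        (F t (x t) - F t (x0 t *\<^sub>R 1) - \<gamma> t *\<^sub>R (B *v tracking_error x x0 t)) t)"

text \<open>Here \<open>y\<close> is \<open>e\<^sub>d\<close> with base point \<open>Inf T\<close>, and \<open>l\<close>, \<open>m\<close> are the
  limits of the norm of the error and of \<open>1 / e\<^sub>d\<close>.\<close>

definition exponentially_stable ::
  "real set \<Rightarrow> (real \<Rightarrow> real^'n \<Rightarrow> real^'n) \<Rightarrow> (real \<Rightarrow> real) \<Rightarrow> real^'n^'n \<Rightarrow>
   (real \<Rightarrow> real) \<Rightarrow> bool" where
  "exponentially_stable T F \<gamma> B x0 \<longleftrightarrow>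
     (\<exists>c>0. \<exists>d>0. \<exists>y m. is_scalar_exponential T d (Inf T) y \<and>
        ((\<lambda>t. 1 / y t) \<longlongrightarrow> m) (inf at_top (principal T)) \<and>
        (\<forall>x. rd_continuous T x \<and> is_solution T F \<gamma> B x0 x \<longrightarrow>
           (\<exists>l. ((\<lambda>t. norm (tracking_error x x0 t)) \<longlongrightarrow> l) (inf at_top (principal T)) \<and>
                l \<le> c * norm (tracking_error x x0 (Inf T)) * m \<and>
                c * norm (tracking_error x x0 (Inf T)) * m = 0)))"

end

theory Submission
  imports Defs
begin

text \<open>
  The stability predicate asks for two things: some exponential \<open>e\<^sub>d\<close> on \<open>T\<close> must exist and
  tend to infinity, and the error of every solution must tend to zero. Both rest on one
  observation (\<open>finite_right_scattered\<close>): the bound \<open>\<delta> \<le> \<mu> \<gamma> \<lambda>\<close> at right-scattered points and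
  the local boundedness of an rd-continuous \<open>\<gamma>\<close> prevent the gaps of \<open>T\<close> from accumulating.

  Since only finitely many gaps precede a point, \<open>e\<^sub>1\<close> has a closed form, and
  \<open>1 + (t - Inf T)\<close> is a lower bound for it (\<open>unit_exponential_ge\<close>). For the same reason the
  switching points are attained and either become infinite or tend to infinity, so the pieces
  exhaust \<open>T\<close> (\<open>piece_kind\<close>, \<open>pieces_cover\<close>).

  The error is followed from piece to piece. At a right-scattered point the linear part of
  the equation multiplies it by a matrix of norm at most \<open>M\<close> and the nonlinearity adds at most
  \<open>\<mu>\<^sup>* L\<close>, which gives the factor \<open>M + \<mu>\<^sup>* L\<close> (\<open>jump_bound\<close>). A dense run is a real interval on
  which the equation is an ordinary differential equation. There an energy estimate, with the
  least eigenvalue of \<open>\<plusminus> B\<close> as the contraction rate, shows that the error grows at most by the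
  factor \<open>exp (L (t - a)) M powr \<integral> \<bar>\<gamma>\<bar>\<close> over \<open>[a, t]\<close> (\<open>dense_run_bound\<close>). Multiplying these
  factors (\<open>switched_bound\<close>), and enlarging \<open>L\<close> to \<open>L / M\<close>, yields the norm of the initial error
  times the functions whose limits are assumed to be zero.
\<close>

section \<open>Time scales whose gaps do not accumulate\<close>

locale unbounded_time_scale =
  fixes T :: "real set"
  assumes closed_T: "closed T" and nonempty_T: "T \<noteq> {}"
    and bdd_below_T: "bdd_below T" and not_bdd_above_T: "\<not> bdd_above T"
begin

lemma exists_greater: "\<exists>s\<in>T. t < s"
  using not_bdd_above_T by (meson bdd_above.I not_less)

lemma Inf_in: "Inf T \<in> T"
  by (simp add: bdd_below_T closed_T closed_contains_Inf nonempty_T)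

lemma Inf_le: "t \<in> T \<Longrightarrow> Inf T \<le> t"
  by (simp add: bdd_below_T cInf_lower)

lemma bdd_below_after: "bdd_below {s \<in> T. t < s}"
  by (rule bdd_belowI[of _ t]) auto

lemma after_nonempty: "{s \<in> T. t < s} \<noteq> {}"
  using exists_greater by auto

lemma sigma_ge: "t \<le> sigma T t"
  unfolding sigma_def by (rule cInf_greatest[OF after_nonempty]) auto

lemma sigma_le: "s \<in> T \<Longrightarrow> t < s \<Longrightarrow> sigma T t \<le> s"
  unfolding sigma_def by (rule cInf_lower[OF _ bdd_below_after]) auto

lemma sigma_in: "sigma T t \<in> T"
proof -
  have "sigma T t \<in> closure {s \<in> T. t < s}"
    unfolding sigma_def by (rule closure_contains_Inf[OF after_nonempty bdd_below_after])
  also have "\<dots> \<subseteq> T" by (rule closure_minimal[OF _ closed_T]) auto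
  finally show ?thesis .
qed

lemma scattered_in: "t \<in> right_scattered T \<Longrightarrow> t \<in> T"
  by (simp add: right_scattered_def)

lemma dense_in: "t \<in> right_dense T \<Longrightarrow> t \<in> T"
  by (simp add: right_dense_def)

lemma dense_iff_not_scattered: "t \<in> T \<Longrightarrow> t \<in> right_dense T \<longleftrightarrow> t \<notin> right_scattered T"
  using sigma_ge[of t] by (auto simp: right_dense_def right_scattered_def)

lemma graininess_nonneg: "0 \<le> graininess T t"
  using sigma_ge[of t] by (simp add: graininess_def)

lemma delta_derivative_step:
  assumes "has_delta_derivative T f D t" "t \<in> T"
  shows "f (sigma T t) = f t + graininess T t *\<^sub>R D"
proof -
  have "norm (f (sigma T t) - f t - (sigma T t - t) *\<^sub>R D) \<le> 0 + e" if "e > 0" for e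
  proof -
    define e' where "e' = e / (\<bar>sigma T t - t\<bar> + 1)"
    have "e' > 0" using that by (simp add: e'_def add_nonneg_pos)
    then have "norm (f (sigma T t) - f t - (sigma T t - t) *\<^sub>R D) \<le> e' * \<bar>sigma T t - t\<bar>"
      using assms unfolding has_delta_derivative_def by fastforce
    also have "\<dots> \<le> 0 + e"
      using that by (simp add: e'_def divide_simps add_nonneg_pos)
    finally show ?thesis .
  qed
  then have "norm (f (sigma T t) - f t - (sigma T t - t) *\<^sub>R D) \<le> 0"
    by (rule field_le_epsilon)
  then show ?thesis by (simp add: graininess_def algebra_simps)
qed

text \<open>Differentiability gives continuity at scattered points too. This is what makes the error
  continuous at the right end of a dense run, where it need not have a classical derivative.\<close>

lemma delta_derivative_imp_continuous:
  assumes "has_delta_derivative T f D t" "t \<in> T"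
  shows "(f \<longlongrightarrow> f t) (at t within T)"
proof (rule tendstoI)
  fix e :: real assume "e > 0"
  let ?m = "graininess T t"
  \<comment> \<open>The increment is \<open>f s - f t = (s - t) *\<^sub>R D - R\<close> with a remainder \<open>R\<close> of norm at most
     \<open>e' * (?m + 1)\<close>; each summand receives half of \<open>e\<close>.\<close>
  define e' where "e' = e / (2 * (?m + 1))"
  define c where "c = norm D + 1"
  have "c > 0" by (simp add: c_def add_nonneg_pos)
  have "e' > 0" using \<open>e > 0\<close> graininess_nonneg[of t] by (simp add: e'_def)
  then obtain r where "r > 0" and r: "\<And>s. s \<in> T \<Longrightarrow> \<bar>s - t\<bar> < r \<Longrightarrow>
      norm (f (sigma T t) - f s - (sigma T t - s) *\<^sub>R D) \<le> e' * \<bar>sigma T t - s\<bar>"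
    using assms unfolding has_delta_derivative_def by meson
  define \<rho> where "\<rho> = min r (min 1 (e / (2 * c)))"
  have "\<rho> > 0" using \<open>r > 0\<close> \<open>e > 0\<close> \<open>c > 0\<close> by (simp add: \<rho>_def)
  have "dist (f s) (f t) < e" if "s \<in> T" "dist s t < \<rho>" for s
  proof -
    have st: "\<bar>s - t\<bar> < r" "\<bar>s - t\<bar> < 1" "\<bar>s - t\<bar> < e / (2 * c)"
      using that by (auto simp: \<rho>_def dist_real_def)
    have "f s - f t = (s - t) *\<^sub>R D - (f (sigma T t) - f s - (sigma T t - s) *\<^sub>R D)"
      using delta_derivative_step[OF assms] by (simp add: graininess_def algebra_simps)
    then have "norm (f s - f t) \<le> norm ((s - t) *\<^sub>R D)
        + norm (f (sigma T t) - f s - (sigma T t - s) *\<^sub>R D)"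
      by (metis norm_triangle_ineq4)
    also have "\<dots> \<le> \<bar>s - t\<bar> * norm D + e' * \<bar>sigma T t - s\<bar>"
      using r[OF \<open>s \<in> T\<close> st(1)] by simp
    also have "e' * \<bar>sigma T t - s\<bar> \<le> e' * (?m + 1)"
      using st(2) graininess_nonneg[of t] \<open>e' > 0\<close>
      by (intro mult_left_mono) (auto simp: graininess_def)
    also have "e' * (?m + 1) = e / 2"
      using graininess_nonneg[of t] by (simp add: e'_def field_simps)
    also have "\<bar>s - t\<bar> * norm D \<le> \<bar>s - t\<bar> * c" by (simp add: c_def mult_left_mono)
    also have "\<bar>s - t\<bar> * c < e / (2 * c) * c"
      using st(3) by (intro mult_strict_right_mono) (auto simp: \<open>c > 0\<close>)
    also have "\<dots> = e / 2"
      using \<open>c > 0\<close> by simp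
    finally show ?thesis by (simp add: dist_norm)
  qed
  then show "\<forall>\<^sub>F s in at t within T. dist (f s) (f t) < e"
    unfolding eventually_at using \<open>\<rho> > 0\<close> by (auto intro!: exI[of _ \<rho>])
qed

lemma delta_derivative_dense_iff:
  assumes "t \<in> right_dense T"
  shows "has_delta_derivative T f D t \<longleftrightarrow> (f has_vector_derivative D) (at t within T)"
proof -
  have "sigma T t = t" using assms by (simp add: right_dense_def)
  moreover have "norm (f t - f s - (t - s) *\<^sub>R D) = norm (f s - f t - (s - t) *\<^sub>R D)" for s
    by (subst norm_minus_commute) (simp add: algebra_simps)
  ultimately show ?thesis
    unfolding has_delta_derivative_def has_vector_derivative_def has_derivative_within_alt
    by (simp add: bounded_linear_scaleR_left abs_minus_commute)
qed

text \<open>At a scattered point only the jump carries information about the derivative: near \<open>t\<close>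
  the increment \<open>sigma T t - s\<close> stays away from zero, so continuity bounds the remainder.\<close>

lemma delta_derivative_scatteredI:
  assumes t: "t \<in> right_scattered T" and cont: "(f \<longlongrightarrow> f t) (at t within T)"
    and step: "f (sigma T t) = f t + graininess T t *\<^sub>R D"
  shows "has_delta_derivative T f D t"
  unfolding has_delta_derivative_def
proof (intro allI impI)
  fix e :: real assume "e > 0"
  let ?m = "graininess T t"
  have m: "?m > 0" using t by (simp add: right_scattered_def graininess_def)
  have "((\<lambda>s. f t - f s + (s - t) *\<^sub>R D) \<longlongrightarrow> f t - f t + (t - t) *\<^sub>R D) (at t within T)"
    by (intro tendsto_intros cont)
  then have "\<forall>\<^sub>F s in at t within T. dist (f t - f s + (s - t) *\<^sub>R D) 0 < e * ?m"
    using m \<open>e > 0\<close> by (auto dest!: tendstoD[where e="e * ?m"])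
  then obtain r where "r > 0" and r: "\<And>s. s \<in> T \<Longrightarrow> s \<noteq> t \<Longrightarrow> dist s t < r \<Longrightarrow>
      norm (f t - f s + (s - t) *\<^sub>R D) < e * ?m"
    unfolding eventually_at by (auto simp: dist_norm)
  show "\<exists>r>0. \<forall>s\<in>T. \<bar>s - t\<bar> < r \<longrightarrow>
      norm (f (sigma T t) - f s - (sigma T t - s) *\<^sub>R D) \<le> e * \<bar>sigma T t - s\<bar>"
  proof (intro exI[of _ "min r ?m"] conjI ballI impI)
    show "min r ?m > 0" using \<open>r > 0\<close> m by simp
    fix s assume s: "s \<in> T" "\<bar>s - t\<bar> < min r ?m"
    have "s \<le> t" using sigma_le[of s t] s by (force simp: graininess_def)
    then have "?m \<le> \<bar>sigma T t - s\<bar>" using m by (simp add: graininess_def)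
    then have le: "e * ?m \<le> e * \<bar>sigma T t - s\<bar>" using \<open>e > 0\<close> by simp
    have eq: "f (sigma T t) - f s - (sigma T t - s) *\<^sub>R D = f t - f s + (s - t) *\<^sub>R D"
      by (simp add: step graininess_def algebra_simps)
    have "norm (f t - f s + (s - t) *\<^sub>R D) \<le> e * ?m"
      using r[of s] s m \<open>e > 0\<close> by (cases "s = t") (auto simp: dist_real_def)
    then show "norm (f (sigma T t) - f s - (sigma T t - s) *\<^sub>R D) \<le> e * \<bar>sigma T t - s\<bar>"
      unfolding eq using le by linarith
  qed
qed

text \<open>A missing real number would leave a gap, and the last point of \<open>T\<close> before the gap would
  be right-scattered.\<close>

lemma dense_run_interval:
  assumes "a \<in> T" "b \<in> T" and dense: "{s \<in> T. a \<le> s \<and> s < b} \<subseteq> right_dense T"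
  shows "{a..b} \<subseteq> T"
proof (rule subsetI, rule ccontr)
  fix x assume x: "x \<in> {a..b}" "x \<notin> T"
  let ?S = "{s \<in> T. s \<le> x}"
  have S: "a \<in> ?S" "bdd_above ?S" using x assms by (auto intro: bdd_aboveI[of _ x])
  have "closed ?S" using closed_Int[OF closed_T closed_atMost[of x]]
    by (simp add: Int_def)
  then have u: "Sup ?S \<in> ?S" by (rule closed_contains_Sup[OF _ S(2), rotated]) (use S(1) in blast)
  moreover have "a \<le> Sup ?S" using S by (rule cSup_upper)
  moreover have "Sup ?S \<noteq> x" using u x by auto
  ultimately have "Sup ?S \<in> right_dense T" "Sup ?S < x" using dense x by auto
  moreover have "x \<le> s" if "s \<in> T" "Sup ?S < s" for s
    using that cSup_upper[OF _ S(2), of s] by force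
  then have "x \<le> sigma T (Sup ?S)" unfolding sigma_def
    by (intro cInf_greatest after_nonempty) auto
  ultimately show False by (simp add: right_dense_def)
qed

text \<open>Gaps cannot accumulate. Near an accumulation point they would have graininess tending to
  zero, while \<gamma> stays bounded there: by continuity if the point is approached from the
  right, since it is then right-dense, and by the existence of the left limit otherwise. So
  \<open>graininess T t * \<gamma> t\<close> could not stay above a positive constant.\<close>

lemma finite_right_scattered:
  assumes rd: "rd_continuous T \<gamma>" and "0 < \<delta>"
    and gap: "\<And>t. t \<in> right_scattered T \<Longrightarrow> \<delta> \<le> graininess T t * \<gamma> t * c"
  shows "finite {s \<in> right_scattered T. s < t}"
proof (rule ccontr)
  let ?A = "{s \<in> right_scattered T. s < t}"
  assume inf: "infinite ?A"
  have "bounded ?A"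
    by (rule bounded_subset[of "{Inf T..t}"]) (auto simp: scattered_in Inf_le)
  then obtain l where "l islimpt ?A" using inf bounded_infinite_imp_islimpt[of ?A ?A] by auto
  then have lim: "l islimpt right_scattered T" by (rule islimpt_subset) auto
  have "l islimpt T" using lim by (rule islimpt_subset) (auto simp: scattered_in)
  then have "l \<in> T" using closed_T closed_limpt by blast
  let ?R = "right_scattered T \<inter> {l<..}" and ?S = "right_scattered T \<inter> {..<l}"
  \<comment> \<open>A one-sided limit of \<gamma> bounds \<gamma> near \<open>l\<close>, while the graininess becomes arbitrarily
     small there; this contradicts the lower bound \<delta>.\<close>
  have no: False
    if lim_k: "(\<gamma> \<longlongrightarrow> k) (at l within U)"
      and small: "\<And>\<rho>. \<rho> > 0 \<Longrightarrow> \<exists>s\<in>right_scattered T \<inter> U - {l}. \<bar>s - l\<bar> < \<rho> \<and> graininess T s < \<rho>"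
    for k and U :: "real set"
  proof -
    obtain r where "r > 0" and r: "\<And>s. s \<in> U \<Longrightarrow> s \<noteq> l \<Longrightarrow> dist s l < r \<Longrightarrow> dist (\<gamma> s) k < 1"
      using tendstoD[OF lim_k, of 1] unfolding eventually_at by auto
    define C where "C = (\<bar>k\<bar> + 1) * \<bar>c\<bar> + 1"
    have "C > 0" by (simp add: C_def add_nonneg_pos)
    then obtain s where s: "s \<in> right_scattered T" "s \<in> U" "s \<noteq> l" "\<bar>s - l\<bar> < r"
        "graininess T s < \<delta> / C"
      using small[of "min r (\<delta> / C)"] \<open>r > 0\<close> \<open>0 < \<delta>\<close> by auto
    have "\<bar>\<gamma> s\<bar> \<le> \<bar>k\<bar> + 1" using r[of s] s by (auto simp: dist_real_def)
    then have "\<bar>\<gamma> s\<bar> * \<bar>c\<bar> \<le> C" by (simp add: C_def mult_right_mono add_increasing2)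
    then have "\<gamma> s * c \<le> C" by (metis abs_ge_self abs_mult order_trans)
    then have "graininess T s * (\<gamma> s * c) \<le> graininess T s * C"
      by (rule mult_left_mono[OF _ graininess_nonneg])
    also have "\<dots> < \<delta>" using s(5) \<open>C > 0\<close> by (simp add: field_simps)
    finally show False using gap[OF s(1)] by (simp add: mult.assoc)
  qed
  have "l islimpt (?R \<union> ?S)"
    unfolding islimpt_def
  proof (intro allI impI)
    fix U assume "l \<in> U" "open U"
    then obtain y where "y \<in> right_scattered T" "y \<in> U" "y \<noteq> l"
      using lim unfolding islimpt_def by blast
    then show "\<exists>y\<in>?R \<union> ?S. y \<in> U \<and> y \<noteq> l" by (intro bexI[of _ y]) auto
  qed
  then consider "l islimpt ?R" | "l islimpt ?S" by (auto simp: islimpt_Un)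
  then show False
  proof cases
    case 1
    have near: "\<exists>s\<in>?R. s < l + \<rho>" if pos: "\<rho> > 0" for \<rho>
    proof -
      obtain s where "s \<in> ?R" "dist s l < \<rho>"
        using 1 pos unfolding islimpt_approachable by blast
      then show ?thesis by (intro bexI[of _ s]) (auto simp: dist_real_def)
    qed
    have "sigma T l \<le> l + \<rho>" if pos: "\<rho> > 0" for \<rho>
    proof -
      obtain s where "s \<in> ?R" "s < l + \<rho>" using near[OF pos] by blast
      then show ?thesis using sigma_le[of s l] scattered_in by force
    qed
    then have "sigma T l \<le> l" by (rule field_le_epsilon)
    then have "sigma T l = l" using sigma_ge[of l] by (rule order_antisym)
    then have "l \<in> right_dense T" using \<open>l \<in> T\<close> by (simp add: right_dense_def)
    then have "(\<gamma> \<longlongrightarrow> \<gamma> l) (at l within T)" using rd by (simp add: rd_continuous_def)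
    then show False
    proof (rule no)
      fix \<rho> :: real assume "\<rho> > 0"
      then obtain q where q: "q \<in> ?R" "q < l + \<rho>" using near by blast
      then obtain s where s: "s \<in> ?R" "s < l + (q - l)" using near[of "q - l"] by auto
      then have "sigma T s \<le> q" using sigma_le[of q s] q scattered_in by auto
      then show "\<exists>s\<in>right_scattered T \<inter> T - {l}. \<bar>s - l\<bar> < \<rho> \<and> graininess T s < \<rho>"
        using q s scattered_in by (intro bexI[of _ s]) (auto simp: graininess_def)
    qed
  next
    case 2
    have near: "\<exists>s\<in>?S. l - \<rho> < s" if pos: "\<rho> > 0" for \<rho>
    proof -
      obtain s where "s \<in> ?S" "dist s l < \<rho>"
        using 2 pos unfolding islimpt_approachable by blast
      then show ?thesis by (intro bexI[of _ s]) (auto simp: dist_real_def)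
    qed
    have near': "\<exists>s\<in>{s\<in>T. s < l}. l - \<rho> < s" if "\<rho> > 0" for \<rho>
      using near[OF that] scattered_in by auto
    have "Sup {s \<in> T. s < l} = l"
    proof (rule cSup_eq_non_empty)
      show "{s \<in> T. s < l} \<noteq> {}" using near'[of 1] by auto
      show "x \<le> l" if "x \<in> {s \<in> T. s < l}" for x using that by auto
      show "l \<le> y" if "\<And>x. x \<in> {s \<in> T. s < l} \<Longrightarrow> x \<le> y" for y
      proof (rule ccontr)
        assume "\<not> l \<le> y"
        then obtain s where "s \<in> {s\<in>T. s < l}" "l - (l - y) < s" using near'[of "l - y"] by auto
        then show False using that[of s] by auto
      qed
    qed
    then have "l \<in> left_dense T" using \<open>l \<in> T\<close> near'[of 1] by (auto simp: left_dense_def)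
    then obtain k where "(\<gamma> \<longlongrightarrow> k) (at l within {s \<in> T. s < l})"
      using rd unfolding rd_continuous_def by blast
    then show False
    proof (rule no)
      fix \<rho> :: real assume "\<rho> > 0"
      then obtain s where s: "s \<in> ?S" "l - \<rho> < s" using near by blast
      then have "sigma T s \<le> l" using sigma_le[of l s] \<open>l \<in> T\<close> by auto
      then show "\<exists>s\<in>right_scattered T \<inter> {s \<in> T. s < l} - {l}.
          \<bar>s - l\<bar> < \<rho> \<and> graininess T s < \<rho>"
        using s scattered_in by (intro bexI[of _ s]) (auto simp: graininess_def)
    qed
  qed
qed

end

declare switch_point.simps(2) [simp del]

locale locally_finite_gaps = unbounded_time_scale +
  assumes finite_gaps: "finite {s \<in> right_scattered T. s < t}"
begin

lemma gaps_before_locally_constant: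
  assumes "t \<in> T"
  shows "\<exists>d>0. \<forall>s\<in>T. dist s t < d \<longrightarrow>
    {q \<in> right_scattered T. q < s} = {q \<in> right_scattered T. q < t}"
proof -
  \<comment> \<open>No other scattered point is closer to \<open>t\<close> than \<open>d\<close>, and past a scattered \<open>t\<close> the next point of
     \<open>T\<close> is a whole graininess away.\<close>
  obtain d where "d > 0"
    and d: "\<And>q. q \<in> right_scattered T \<Longrightarrow> q < t + 1 \<Longrightarrow> q \<noteq> t \<Longrightarrow> d \<le> dist t q"
    using finite_set_avoid[OF finite_gaps[of "t + 1"], of t] by auto
  define e where "e = min (min 1 d) (if t \<in> right_scattered T then graininess T t else 1)"
  have "e > 0" using \<open>d > 0\<close> by (auto simp: e_def right_scattered_def graininess_def)
  moreover have "q < s \<longleftrightarrow> q < t" if s: "s \<in> T" "dist s t < e" and q: "q \<in> right_scattered T" for s q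
  proof (cases "q = t")
    case True
    then have "\<not> t < s" using sigma_le[of s t] s q by (auto simp: e_def graininess_def dist_real_def)
    then show ?thesis using True by simp
  next
    case False
    then show ?thesis using d[OF q] s by (force simp: e_def dist_real_def)
  qed
  ultimately show ?thesis by blast
qed

lemma gaps_before_sigma:
  assumes "t \<in> right_scattered T"
  shows "{q \<in> right_scattered T. q < sigma T t} = insert t {q \<in> right_scattered T. q < t}"
proof -
  have t_less: "t < sigma T t" using assms by (simp add: right_scattered_def)
  have "\<not> t < q" if "q \<in> T" "q < sigma T t" for q
    using sigma_le[of q t] that by auto
  then have "q < sigma T t \<longleftrightarrow> q = t \<or> q < t" if "q \<in> right_scattered T" for q
    using \<open>\<And>q. q \<in> T \<Longrightarrow> q < sigma T t \<Longrightarrow> \<not> t < q\<close>[OF scattered_in[OF that]] t_less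
    by (metis less_linear less_trans)
  then show ?thesis using assms by blast
qed

section \<open>The exponential function of the time scale\<close>

text \<open>The exponential \<open>e\<^sub>1\<close> with base point \<open>Inf T\<close>: each gap before \<open>t\<close> contributes the
  factor \<open>1 + graininess\<close>, and \<open>exp (t - Inf T)\<close> with the total gap length removed from the
  exponent is the growth along the dense part.\<close>

definition unit_exponential :: "real \<Rightarrow> real" where
  "unit_exponential t = exp (t - Inf T) *
     (\<Prod>s\<in>{s \<in> right_scattered T. s < t}. (1 + graininess T s) * exp (- graininess T s))"

lemma unit_exponential_is_exponential: "is_scalar_exponential T 1 (Inf T) unit_exponential"
  unfolding is_scalar_exponential_def
proof (intro conjI ballI)
  have empty: "{s \<in> right_scattered T. s < Inf T} = {}" using Inf_le scattered_in by force
  show "unit_exponential (Inf T) = 1" unfolding unit_exponential_def empty by simp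
  fix t assume "t \<in> T"
  define P where "P = (\<Prod>s\<in>{s \<in> right_scattered T. s < t}. (1 + graininess T s) * exp (- graininess T s))"
  obtain d where "d > 0" and const: "\<And>s. s \<in> T \<Longrightarrow> dist s t < d \<Longrightarrow>
      {q \<in> right_scattered T. q < s} = {q \<in> right_scattered T. q < t}"
    using gaps_before_locally_constant[OF \<open>t \<in> T\<close>] by blast
  have d: "exp (s - Inf T) * P = unit_exponential s" if "s \<in> T" "dist s t < d" for s
    unfolding P_def unit_exponential_def const[OF that] ..
  have at_t: "unit_exponential t = exp (t - Inf T) * P" using d[OF \<open>t \<in> T\<close>] \<open>d > 0\<close> by simp
  have "((\<lambda>s. exp (s - Inf T) * P) has_real_derivative exp (t - Inf T) * P) (at t within T)"
    by (auto intro!: derivative_eq_intros)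
  then have "((\<lambda>s. exp (s - Inf T) * P) has_vector_derivative unit_exponential t) (at t within T)"
    by (simp add: at_t has_real_derivative_iff_has_vector_derivative)
  then have der: "(unit_exponential has_vector_derivative unit_exponential t) (at t within T)"
    by (rule has_vector_derivative_transform_within[OF _ \<open>d > 0\<close> \<open>t \<in> T\<close> d])
  show "has_delta_derivative T unit_exponential (1 * unit_exponential t) t"
  proof (cases "t \<in> right_scattered T")
    case True
    have "(unit_exponential \<longlongrightarrow> unit_exponential t) (at t within T)"
      using has_vector_derivative_continuous[OF der] by (simp add: continuous_within)
    moreover have "unit_exponential (sigma T t)
        = unit_exponential t + graininess T t *\<^sub>R (1 * unit_exponential t)"
    proof -
      have "unit_exponential (sigma T t) = exp (sigma T t - Inf T) *
          ((1 + graininess T t) * exp (- graininess T t) * P)"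
        unfolding unit_exponential_def P_def gaps_before_sigma[OF True]
        by (subst prod.insert) (auto simp: finite_gaps)
      also have "exp (sigma T t - Inf T) = exp (graininess T t) * exp (t - Inf T)"
        by (simp add: graininess_def flip: exp_add)
      also have "exp (graininess T t) * exp (t - Inf T) *
          ((1 + graininess T t) * exp (- graininess T t) * P) = exp (t - Inf T) * P * (1 + graininess T t)"
        by (simp add: exp_minus)
      finally show ?thesis by (simp add: at_t algebra_simps)
    qed
    ultimately show ?thesis by (rule delta_derivative_scatteredI[OF True])
  next
    case False
    then have "t \<in> right_dense T" using dense_iff_not_scattered \<open>t \<in> T\<close> by simp
    then show ?thesis using der by (simp add: delta_derivative_dense_iff)
  qed
qed

text \<open>Bernoulli's inequality for time scales. Passing the last gap before \<open>t\<close> preserves the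
  bound, so it follows by induction over the gaps.\<close>

lemma unit_exponential_ge:
  assumes "t \<in> T"
  shows "1 + (t - Inf T) \<le> unit_exponential t"
proof -
  \<comment> \<open>The set \<open>S\<close> of gaps is arbitrary, which lets the induction remove the last one.\<close>
  have "1 + (t - Inf T) \<le> exp (t - Inf T) * (\<Prod>s\<in>S. (1 + graininess T s) * exp (- graininess T s))"
    if "finite S" "S \<subseteq> right_scattered T" "t \<in> T" "\<forall>s\<in>S. s < t" for S t
    using that
  proof (induction S arbitrary: t rule: finite_linorder_max_induct)
    case empty
    then show ?case by simp
  next
    case (insert b S)
    have b: "b \<in> T" using insert.prems scattered_in by blast
    have IH: "1 + (b - Inf T) \<le> exp (b - Inf T) *
        (\<Prod>s\<in>S. (1 + graininess T s) * exp (- graininess T s))"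
      using insert.prems insert.hyps b by (intro insert.IH) auto
    have "sigma T b \<le> t" using insert.prems sigma_le by auto
    have product: "1 + (x + y + z) \<le> (1 + x) * ((1 + y) * (1 + z))"
      if "0 \<le> x" "0 \<le> y" "0 \<le> z" for x y z :: real
    proof -
      have "0 \<le> x * y" "0 \<le> x * z" "0 \<le> y * z" "0 \<le> x * (y * z)" using that by simp_all
      then show ?thesis by (simp add: algebra_simps)
    qed
    have "1 + (t - Inf T) = 1 + ((t - sigma T b) + graininess T b + (b - Inf T))"
      by (simp add: graininess_def)
    also have "\<dots> \<le> (1 + (t - sigma T b)) * ((1 + graininess T b) * (1 + (b - Inf T)))"
      using \<open>sigma T b \<le> t\<close> graininess_nonneg[of b] Inf_le[OF b] by (intro product) simp_all
    also have "\<dots> \<le> exp (t - sigma T b) * ((1 + graininess T b) * (exp (b - Inf T) *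
        (\<Prod>s\<in>S. (1 + graininess T s) * exp (- graininess T s))))"
      using \<open>sigma T b \<le> t\<close> graininess_nonneg[of b] Inf_le[OF b]
      by (intro mult_mono IH exp_ge_add_one_self order_refl mult_nonneg_nonneg) simp_all
    also have "exp (t - sigma T b) = exp (t - Inf T) / (exp (graininess T b) * exp (b - Inf T))"
      by (simp add: graininess_def flip: exp_diff exp_add)
    also have "\<dots> * ((1 + graininess T b) * (exp (b - Inf T) *
        (\<Prod>s\<in>S. (1 + graininess T s) * exp (- graininess T s)))) =
        exp (t - Inf T) * ((1 + graininess T b) * exp (- graininess T b) *
        (\<Prod>s\<in>S. (1 + graininess T s) * exp (- graininess T s)))"
      by (simp add: exp_minus[of "graininess T b"] divide_simps)
    also have "\<dots> = exp (t - Inf T) *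
        (\<Prod>s\<in>insert b S. (1 + graininess T s) * exp (- graininess T s))"
      using insert.hyps by (subst prod.insert) auto
    finally show ?case .
  qed
  then show ?thesis unfolding unit_exponential_def
    using finite_gaps assms by auto
qed

lemma unit_exponential_decay:
  "((\<lambda>t. 1 / unit_exponential t) \<longlongrightarrow> 0) (inf at_top (principal T))"
proof -
  have "filterlim (\<lambda>t. (1 - Inf T) + t) at_top (inf at_top (principal T))"
    by (rule filterlim_mono[OF filterlim_tendsto_add_at_top[OF tendsto_const filterlim_ident]
          order_refl inf_le1])
  then have "filterlim unit_exponential at_top (inf at_top (principal T))"
    by (rule filterlim_at_top_mono)
       (use unit_exponential_ge in \<open>simp add: eventually_inf_principal algebra_simps\<close>)
  then show ?thesis
    using tendsto_inverse_0_at_top by (simp add: inverse_eq_divide)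
qed

section \<open>Switching points and pieces\<close>

text \<open>The kind of points that make up the piece number \<open>j\<close>; the point where the next piece
  starts is of kind \<open>Suc j\<close>.\<close>

abbreviation kind :: "nat \<Rightarrow> real set" where
  "kind j \<equiv> if even j then right_scattered T else right_dense T"

lemma kind_in: "t \<in> kind j \<Longrightarrow> t \<in> T"
  by (auto split: if_splits simp: scattered_in dense_in)

lemma kind_Suc_iff: "t \<in> T \<Longrightarrow> t \<in> kind (Suc j) \<longleftrightarrow> t \<notin> kind j"
  using dense_iff_not_scattered by auto

text \<open>The infimum in the definition of the switching points is a minimum. For scattered points
  this is local finiteness. A scattered infimum of right-dense points would itself be isolated
  from the right-dense points above it.\<close>

lemma first_of_kind:
  assumes t: "t \<in> kind (Suc j)" "a \<le> t"
  obtains u where "u \<in> kind (Suc j)" "a \<le> u" "u \<le> t" "{s \<in> T. a \<le> s \<and> s < u} \<subseteq> kind j"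
proof -
  define D where "D = {u \<in> kind (Suc j). a \<le> u}"
  define u where "u = Inf D"
  have D: "t \<in> D" "D \<subseteq> T" using t kind_in[of _ "Suc j"] by (auto simp: D_def simp del: even_Suc)
  have bdd: "bdd_below D" by (rule bdd_belowI[of _ a]) (simp add: D_def)
  have "u \<in> D"
  proof (cases "even j")
    case False
    then have "{s \<in> D. s \<le> t} \<subseteq> {s \<in> right_scattered T. s < t + 1}" by (auto simp: D_def)
    then have fin: "finite {s \<in> D. s \<le> t}" using finite_gaps finite_subset by blast
    let ?m = "Min {s \<in> D. s \<le> t}"
    have m: "?m \<in> D" "?m \<le> t" using Min_in[OF fin] D by auto
    have "?m \<le> s" if "s \<in> D" for s
      using that fin m(2) by (cases "s \<le> t") (auto intro: Min_le)
    then have "u = ?m" unfolding u_def using m(1) by (intro cInf_eq_minimum) auto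
    then show ?thesis using m(1) by simp
  next
    case True
    then have dense: "D = {u \<in> right_dense T. a \<le> u}" by (simp add: D_def)
    have "u \<in> closure D" unfolding u_def by (rule closure_contains_Inf[OF _ bdd]) (use D in auto)
    then have "u \<in> T" using closure_minimal[OF D(2) closed_T] by auto
    have "u \<notin> right_scattered T"
    proof
      assume "u \<in> right_scattered T"
      then have "Inf D < sigma T u" by (simp add: right_scattered_def u_def)
      then obtain d where d: "d \<in> D" "d < sigma T u" using cInf_lessD[of D "sigma T u"] D by auto
      then have "u \<le> d" unfolding u_def using cInf_lower[OF _ bdd] by auto
      moreover have "d \<noteq> u" using d(1) \<open>u \<in> right_scattered T\<close> \<open>u \<in> T\<close> dense_iff_not_scattered
        by (auto simp: dense)
      ultimately show False using sigma_le[of d u] d D by auto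
    qed
    moreover have "a \<le> u" unfolding u_def by (rule cInf_greatest) (use D in \<open>auto simp: D_def\<close>)
    ultimately show ?thesis using dense_iff_not_scattered \<open>u \<in> T\<close> by (simp add: dense)
  qed
  moreover have "u \<le> t" unfolding u_def using cInf_lower[OF _ bdd] D by auto
  moreover have "s \<in> kind j" if s: "s \<in> T" "a \<le> s" "s < u" for s
  proof (rule ccontr)
    assume "s \<notin> kind j"
    then have "s \<in> D" using s kind_Suc_iff[of s j] by (simp add: D_def)
    then show False using cInf_lower[OF _ bdd, of s] s(3) by (simp add: u_def)
  qed
  ultimately show ?thesis using that[of u] by (auto simp: D_def)
qed

lemma switch_point_Suc:
  "switch_point T (Suc j) = Inf {ereal t | t. t \<in> kind (Suc j) \<and> switch_point T j \<le> ereal t \<and>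
     {s \<in> T. switch_point T j \<le> ereal s \<and> s < t} \<subseteq> kind j}"
  by (simp add: switch_point.simps(2))

lemma switch_point_Suc_cases:
  obtains (infinite) "switch_point T (Suc j) = \<infinity>"
  | (finite) u where "switch_point T (Suc j) = ereal u" "u \<in> kind (Suc j)"
      "switch_point T j \<le> ereal u"
proof -
  let ?S = "{t. t \<in> kind (Suc j) \<and> switch_point T j \<le> ereal t \<and>
     {s \<in> T. switch_point T j \<le> ereal s \<and> s < t} \<subseteq> kind j}"
  have eq: "switch_point T (Suc j) = Inf (ereal ` ?S)"
    unfolding switch_point_Suc by (rule arg_cong[where f = Inf]) blast
  \<comment> \<open>Two candidates \<open>u < v\<close> are impossible: \<open>u\<close> would lie in the stretch before \<open>v\<close> and so be of both
     kinds.\<close>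
  have uniq: "\<not> u < v" if "u \<in> ?S" "v \<in> ?S" for u v
  proof
    assume "u < v"
    have "u \<in> T" "u \<in> kind (Suc j)" using that kind_in by blast+
    moreover have "u \<in> kind j" using that \<open>u < v\<close> \<open>u \<in> T\<close> by blast
    ultimately show False using kind_Suc_iff by blast
  qed
  show ?thesis
  proof (cases "?S = {}")
    case True
    have "switch_point T (Suc j) = \<infinity>" unfolding eq True by (simp add: top_ereal_def)
    then show ?thesis by (rule infinite)
  next
    case False
    then obtain u where u: "u \<in> ?S" by blast
    have "v = u" if "v \<in> ?S" for v using uniq[OF u that] uniq[OF that u] by linarith
    then have S: "?S = {u}" using u by blast
    have "switch_point T (Suc j) = ereal u" unfolding eq S by simp
    then show ?thesis using finite u by blast
  qed
qed

lemma switch_point_cases: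
  obtains (infinite) "switch_point T j = \<infinity>" | (finite) a where "switch_point T j = ereal a" "a \<in> T"
proof (cases j)
  case 0
  then show ?thesis using finite Inf_in by simp
next
  case (Suc k)
  show ?thesis
    by (cases rule: switch_point_Suc_cases[of k]) (use Suc finite infinite kind_in in blast)+
qed

lemma switch_point_mono_Suc: "switch_point T j \<le> switch_point T (Suc j)"
  by (cases rule: switch_point_Suc_cases[of j]) simp_all

lemma switch_point_strict:
  assumes "switch_point T (Suc j) \<noteq> \<infinity>"
  shows "switch_point T (Suc j) < switch_point T (Suc (Suc j))"
proof (cases rule: switch_point_Suc_cases[of "Suc j"])
  case infinite
  then show ?thesis using assms by simp
next
  case v: (finite v)
  show ?thesis
  proof (cases rule: switch_point_Suc_cases[of j])
    case infinite
    then show ?thesis using assms by blast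
  next
    case u: (finite u)
    have "u \<noteq> v" using u(2) v(2) kind_Suc_iff[of v "Suc j"] kind_in by blast
    then show ?thesis using u(1) v(1,3) by simp
  qed
qed

lemma piece_kind:
  assumes "t \<in> piece T j"
  shows "t \<in> kind j"
proof (rule ccontr)
  assume "t \<notin> kind j"
  have t: "t \<in> T" "switch_point T j \<le> ereal t" "ereal t < switch_point T (Suc j)"
    using assms by (auto simp: piece_def)
  obtain a where a: "switch_point T j = ereal a"
    using t(2) by (cases rule: switch_point_cases[of j]) auto
  have "t \<in> kind (Suc j)" using \<open>t \<notin> kind j\<close> t(1) kind_Suc_iff by blast
  moreover have "a \<le> t" using t(2) a by simp
  ultimately obtain u where u: "u \<in> kind (Suc j)" "a \<le> u" "u \<le> t" "{s \<in> T. a \<le> s \<and> s < u} \<subseteq> kind j"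
    using first_of_kind by blast
  then have "switch_point T (Suc j) \<le> ereal u"
    unfolding switch_point_Suc a by (intro Inf_lower) auto
  also have "\<dots> \<le> ereal t" using u(3) by simp
  finally show False using t(3) by simp
qed

text \<open>If no switching point exceeded \<open>t\<close>, those with even index would be infinitely many
  right-scattered points up to \<open>t\<close>.\<close>

lemma pieces_cover:
  assumes "t \<in> T"
  obtains j where "t \<in> piece T j"
proof -
  have "\<exists>j. ereal t < switch_point T j"
  proof (rule ccontr)
    assume "\<nexists>j. ereal t < switch_point T j"
    then have le: "switch_point T j \<le> ereal t" for j by (simp add: not_less)
    then have noninf: "switch_point T j \<noteq> \<infinity>" for j using le[of j] by force
    define f where "f j = switch_real T (Suc j)" for j
    have f: "switch_point T (Suc j) = ereal (f j)" "f j \<in> kind (Suc j)" for j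
      unfolding f_def by (cases rule: switch_point_Suc_cases[of j]; use noninf[of "Suc j"] in force)+
    have "strict_mono f"
    proof (rule strict_monoI_Suc)
      fix j
      show "f j < f (Suc j)" using switch_point_strict[OF noninf, of j] by (simp only: f) simp
    qed
    then have "inj (\<lambda>i. f (2 * i + 1))"
      by (auto simp: inj_on_def strict_mono_eq)
    moreover have "range (\<lambda>i. f (2 * i + 1)) \<subseteq> {s \<in> right_scattered T. s < t + 1}"
    proof
      fix x assume "x \<in> range (\<lambda>i. f (2 * i + 1))"
      then obtain i where x: "x = f (2 * i + 1)" by auto
      have "f (2 * i + 1) \<le> t" using le[of "Suc (2 * i + 1)"] by (simp only: f) simp
      then show "x \<in> {s \<in> right_scattered T. s < t + 1}" using f(2)[of "2 * i + 1"] x by simp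
    qed
    ultimately show False
      using finite_gaps[of "t + 1"] finite_subset finite_imageD infinite_UNIV_nat by blast
  qed
  then have ex: "ereal t < switch_point T (LEAST j. ereal t < switch_point T j)"
    by (rule LeastI_ex)
  define k where "k = (LEAST j. ereal t < switch_point T j)"
  have "k \<noteq> 0" using ex Inf_le[OF assms] by (auto simp: k_def[symmetric] intro!: Nat.gr0I)
  then obtain j where j: "k = Suc j" by (cases k) auto
  have "\<not> ereal t < switch_point T j" using not_less_Least[of j "\<lambda>j. ereal t < switch_point T j"] j
    by (simp add: k_def)
  then have "t \<in> piece T j"
    using ex assms j by (simp add: piece_def k_def[symmetric])
  then show ?thesis by (rule that)
qed

end

section \<open>Dense runs\<close>

text \<open>The Rayleigh quotient attains its minimum on the unit sphere, and a minimiser is an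
  eigenvector.\<close>

lemma symmetric_matrix_least_eigenvector:
  fixes A :: "real^'n^'n"
  assumes "transpose A = A"
  obtains r v where "norm v = 1" "A *v v = r *\<^sub>R v" "\<And>x. r * (x \<bullet> x) \<le> x \<bullet> (A *v x)"
proof -
  have sym: "x \<bullet> (A *v y) = (A *v x) \<bullet> y" for x y
    by (metis assms dot_lmul_matrix transpose_matrix_vector)
  let ?S = "sphere 0 1 :: (real^'n) set"
  have "axis undefined 1 \<in> ?S" by (simp add: norm_axis_1)
  then have "?S \<noteq> {}" by blast
  moreover have "continuous_on ?S (\<lambda>x. x \<bullet> (A *v x))"
    by (intro continuous_intros linear_continuous_on matrix_vector_mul_bounded_linear)
  ultimately obtain v where v: "v \<in> ?S" and least: "\<And>x. x \<in> ?S \<Longrightarrow> v \<bullet> (A *v v) \<le> x \<bullet> (A *v x)"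
    using continuous_attains_inf[OF compact_sphere] by blast
  define r where "r = v \<bullet> (A *v v)"
  have nv: "norm v = 1" "v \<bullet> v = 1" using v by (auto simp: dot_square_norm)
  have ray: "r * (x \<bullet> x) \<le> x \<bullet> (A *v x)" for x
  proof (cases "x = 0")
    case False
    have "x \<bullet> x > 0" using False by simp
    have "r \<le> (inverse (norm x) *\<^sub>R x) \<bullet> (A *v (inverse (norm x) *\<^sub>R x))"
      unfolding r_def by (rule least) (use False in simp)
    also have "\<dots> = x \<bullet> (A *v x) / (x \<bullet> x)"
      using False by (simp add: matrix_vector_mult_scaleR dot_square_norm power2_eq_square field_simps)
    finally show ?thesis using \<open>x \<bullet> x > 0\<close> by (simp add: field_simps)
  qed simp
  let ?w = "A *v v - r *\<^sub>R v"
  \<comment> \<open>The nonnegative quadratic form \<open>x \<bullet> (A *v x) - r * (x \<bullet> x)\<close> vanishes at \<open>v\<close>, so its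
     first variation at \<open>v\<close> vanishes as well.\<close>
  have var: "0 \<le> 2 * s * (?w \<bullet> ?w) + s\<^sup>2 * (?w \<bullet> (A *v ?w) - r * (?w \<bullet> ?w))" for s
  proof -
    have "r * ((v + s *\<^sub>R ?w) \<bullet> (v + s *\<^sub>R ?w)) \<le> (v + s *\<^sub>R ?w) \<bullet> (A *v (v + s *\<^sub>R ?w))"
      by (rule ray)
    moreover have "(v + s *\<^sub>R w) \<bullet> (A *v (v + s *\<^sub>R w)) - r * ((v + s *\<^sub>R w) \<bullet> (v + s *\<^sub>R w))
        = 2 * s * (w \<bullet> ?w) + s\<^sup>2 * (w \<bullet> (A *v w) - r * (w \<bullet> w))" for w
    proof -
      have "v \<bullet> (A *v w) = w \<bullet> (A *v v)" by (metis sym inner_commute)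
      then show ?thesis using r_def nv
        by (simp add: matrix_vector_right_distrib matrix_vector_mult_scaleR inner_simps
          inner_commute[of v w] power2_eq_square algebra_simps)
    qed
    ultimately show ?thesis by (metis diff_ge_0_iff_ge)
  qed
  have "?w \<bullet> ?w = 0"
  proof (rule ccontr)
    define p where "p = ?w \<bullet> ?w"
    define q where "q = ?w \<bullet> (A *v ?w) - r * (?w \<bullet> ?w)"
    assume "?w \<bullet> ?w \<noteq> 0"
    then have "p > 0" unfolding p_def by simp
    have "q \<ge> 0" unfolding q_def using ray[of ?w] by simp
    \<comment> \<open>The value \<open>s = - p / (q + 1)\<close> makes the linear term outweigh the quadratic one; the summand
       \<open>1\<close> keeps the denominator positive when \<open>q = 0\<close>.\<close>
    have "0 \<le> 2 * (- p / (q + 1)) * p + (- p / (q + 1))\<^sup>2 * q"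
      unfolding p_def q_def by (rule var)
    also have "\<dots> = - (p\<^sup>2 * (q + 2)) / (q + 1)\<^sup>2"
      using \<open>q \<ge> 0\<close> by (simp add: divide_simps power2_eq_square) (simp add: algebra_simps)
    also have "\<dots> < 0" using \<open>p > 0\<close> \<open>q \<ge> 0\<close> by (simp add: divide_simps)
    finally show False by simp
  qed
  then have "A *v v = r *\<^sub>R v" by simp
  with nv(1) ray show ?thesis using that by blast
qed

text \<open>Gronwall's argument: \<open>u\<close> divided by the solution of the corresponding equation is
  nonincreasing.\<close>

lemma linear_differential_inequality:
  fixes u g :: "real \<Rightarrow> real"
  assumes "a \<le> b" and u: "continuous_on {a..b} u" and g: "continuous_on {a..b} g"
    and der: "\<And>t. a < t \<Longrightarrow> t < b \<Longrightarrow> \<exists>D. (u has_real_derivative D) (at t) \<and> D \<le> g t * u t"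
  shows "u b \<le> u a * exp (integral {a..b} g)"
proof -
  define G where "G t = integral {a..t} g" for t
  have G: "continuous_on {a..b} G"
    unfolding G_def by (rule indefinite_integral_continuous_1[OF integrable_continuous_interval[OF g]])
  have dG: "(G has_real_derivative g t) (at t)" if "a < t" "t < b" for t
  proof -
    have "(G has_real_derivative g t) (at t within {a..b})"
      unfolding G_def by (rule integral_has_real_derivative[OF g]) (use that in auto)
    moreover have "at t within {a..b} = at t"
      by (rule at_within_interior) (use that in auto)
    ultimately show ?thesis by simp
  qed
  have "u b * exp (- G b) \<le> u a * exp (- G a)"
  proof (rule DERIV_nonpos_imp_decreasing_open[OF \<open>a \<le> b\<close>])
    show "continuous_on {a..b} (\<lambda>t. u t * exp (- G t))" by (intro continuous_intros u G)
    fix t assume t: "a < t" "t < b"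
    obtain D where D: "(u has_real_derivative D) (at t)" "D \<le> g t * u t" using der[OF t] by blast
    have "((\<lambda>t. u t * exp (- G t)) has_real_derivative (D - g t * u t) * exp (- G t)) (at t)"
      by (auto intro!: derivative_eq_intros D(1) dG t simp: algebra_simps)
    then show "\<exists>y. ((\<lambda>t. u t * exp (- G t)) has_real_derivative y) (at t) \<and> y \<le> 0"
      using D(2) by (intro exI conjI) (assumption, simp add: mult_le_0_iff)
  qed
  then show ?thesis by (simp add: G_def exp_minus field_simps)
qed

lemma matrix_vector_bound: "norm (A *v x) \<le> spectral_norm A * norm (x::real^'n)"
  unfolding spectral_norm_def by (rule onorm[OF matrix_vector_mul_bounded_linear])

text \<open>The decay of the flow \<open>X\<close> is assumed from the left end point \<open>a\<close> only, so variation of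
  constants, which involves the flow from every intermediate point, is not applicable directly.
  The way around is the least eigenvalue \<open>r\<close> of \<open>A\<close>. The flow shrinks its eigenvector by
  exactly \<open>exp (- r * integral {a..t} p)\<close>, so this number is a lower bound for the norm of the
  flow and hence at most \<open>M powr integral {a..t} p\<close>. Conversely, the derivative of
  \<open>\<epsilon> t \<bullet> \<epsilon> t\<close> is at most \<open>2 * (L - r * p t) * (\<epsilon> t \<bullet> \<epsilon> t)\<close>, which bounds every
  perturbed solution through the same \<open>r\<close>.\<close>

lemma perturbed_flow_bound:
  fixes A :: "real^'n^'n" and X :: "real \<Rightarrow> real^'n^'n" and \<epsilon> G :: "real \<Rightarrow> real^'n"
    and p :: "real \<Rightarrow> real"
  assumes "a \<le> b" and sym: "transpose A = A"
    and p: "continuous_on {a..b} p" and p0: "\<And>t. a \<le> t \<Longrightarrow> t < b \<Longrightarrow> 0 \<le> p t"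
    and X: "continuous_on {a..b} X" and Xa: "X a = mat 1"
    and dX: "\<And>t. a < t \<Longrightarrow> t < b \<Longrightarrow> (X has_vector_derivative (- (p t *\<^sub>R A) ** X t)) (at t)"
    and e: "continuous_on {a..b} \<epsilon>"
    and de: "\<And>t. a < t \<Longrightarrow> t < b \<Longrightarrow> (\<epsilon> has_vector_derivative (G t - p t *\<^sub>R (A *v \<epsilon> t))) (at t)"
    and G: "\<And>t. a < t \<Longrightarrow> t < b \<Longrightarrow> norm (G t) \<le> L * norm (\<epsilon> t)"
    and M: "0 < M"
    and decay: "\<And>t. a \<le> t \<Longrightarrow> t < b \<Longrightarrow> spectral_norm (X t) \<le> M powr integral {a..t} p"
  shows "norm (\<epsilon> b) \<le> norm (\<epsilon> a) * exp (L * (b - a)) * M powr integral {a..b} p"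
proof (cases "a = b")
  case False
  then have "a < b" using \<open>a \<le> b\<close> by simp
  obtain r v where v: "norm v = 1" "A *v v = r *\<^sub>R v"
    and ray: "\<And>x. r * (x \<bullet> x) \<le> x \<bullet> (A *v x)"
    using symmetric_matrix_least_eigenvector[OF sym] by metis
  let ?P = "\<lambda>t. integral {a..t} p"
  have P: "continuous_on {a..b} ?P"
    by (rule indefinite_integral_continuous_1[OF integrable_continuous_interval[OF p]])
  have adj: "v \<bullet> (A *v x) = r * (v \<bullet> x)" for x
    using v(2) by (metis sym dot_lmul_matrix transpose_matrix_vector inner_scaleR_left)
  have bl: "bounded_linear (\<lambda>Y::real^'n^'n. v \<bullet> (Y *v v))"
    by (rule linear_conv_bounded_linear[THEN iffD1], rule linearI)
       (simp_all add: matrix_vector_mult_add_rdistrib inner_simps scaleR_matrix_vector_assoc[symmetric])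
  \<comment> \<open>The component of the flow along the least eigenvector is known exactly; it is a lower
     bound for the norm of \<open>X t\<close>.\<close>
  have low: "- r * ?P t \<le> ln M * ?P t" if t: "t \<in> {a..<b}" for t
  proof -
    let ?h = "\<lambda>s. - (v \<bullet> (X s *v v))"
    have "?h t \<le> ?h a * exp (integral {a..t} (\<lambda>s. - r * p s))"
    proof (rule linear_differential_inequality)
      show "a \<le> t" using t by simp
      have "continuous_on {a..t} X" by (rule continuous_on_subset[OF X]) (use t in auto)
      then show "continuous_on {a..t} ?h"
        by (intro continuous_intros bounded_linear.continuous_on[OF bl])
      show "continuous_on {a..t} (\<lambda>s. - r * p s)"
        by (intro continuous_intros continuous_on_subset[OF p]) (use t in auto)
      fix s assume s: "a < s" "s < t"
      have "(X has_vector_derivative (- (p s *\<^sub>R A) ** X s)) (at s)"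
        using dX[of s] s t by auto
      from bounded_linear.has_vector_derivative[OF bl this]
      have "((\<lambda>s. v \<bullet> (X s *v v)) has_vector_derivative v \<bullet> ((- (p s *\<^sub>R A) ** X s) *v v)) (at s)" .
      moreover have "(- (p s *\<^sub>R A) ** X s) *v v = - (p s) *\<^sub>R (A *v (X s *v v))"
        by (simp add: matrix_vector_mul_assoc[symmetric] scaleR_matrix_vector_assoc[symmetric]
            flip: scaleR_minus_left)
      ultimately have "((\<lambda>s. v \<bullet> (X s *v v)) has_real_derivative - (p s) * (r * (v \<bullet> (X s *v v)))) (at s)"
        by (simp add: adj has_real_derivative_iff_has_vector_derivative)
      from DERIV_minus[OF this]
      show "\<exists>D. (?h has_real_derivative D) (at s) \<and> D \<le> - r * p s * ?h s"
        by (intro exI conjI) (assumption, simp)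
    qed
    moreover have "v \<bullet> (X a *v v) = 1" using v(1) by (simp add: Xa dot_square_norm)
    ultimately have "exp (- r * ?P t) \<le> v \<bullet> (X t *v v)" by simp
    also have "\<dots> \<le> norm v * norm (X t *v v)" by (rule norm_cauchy_schwarz)
    also have "\<dots> \<le> spectral_norm (X t)" using matrix_vector_bound[of "X t" v] v(1) by simp
    also have "\<dots> \<le> M powr ?P t" using decay t by simp
    finally show ?thesis using M by (simp add: powr_def mult.commute)
  qed
  \<comment> \<open>The decay is known at points before \<open>b\<close>; continuity carries the comparison to \<open>b\<close>.\<close>
  have "0 \<le> ln M * ?P b - - r * ?P b"
  proof (rule continuous_ge_on_closure[where S = "{a..<b}" and f = "\<lambda>t. ln M * ?P t - - r * ?P t"])
    show "continuous_on (closure {a..<b}) (\<lambda>t. ln M * ?P t - - r * ?P t)"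
      using \<open>a < b\<close> by (intro continuous_intros) (simp_all add: P)
    show "b \<in> closure {a..<b}" using \<open>a < b\<close> by simp
  qed (use low in force)
  then have Pb: "exp (- r * ?P b) \<le> M powr ?P b" using M by (simp add: powr_def mult.commute)
  have "\<epsilon> b \<bullet> \<epsilon> b \<le> \<epsilon> a \<bullet> \<epsilon> a * exp (integral {a..b} (\<lambda>t. 2 * L - 2 * r * p t))"
  proof (rule linear_differential_inequality[OF \<open>a \<le> b\<close>])
    show "continuous_on {a..b} (\<lambda>t. \<epsilon> t \<bullet> \<epsilon> t)" by (intro continuous_intros e)
    show "continuous_on {a..b} (\<lambda>t. 2 * L - 2 * r * p t)" by (intro continuous_intros p)
    fix t assume t: "a < t" "t < b"
    let ?D = "G t - p t *\<^sub>R (A *v \<epsilon> t)"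
    have "((\<lambda>t. \<epsilon> t \<bullet> \<epsilon> t) has_vector_derivative (\<epsilon> t \<bullet> ?D + ?D \<bullet> \<epsilon> t)) (at t)"
      by (rule bounded_bilinear.has_vector_derivative[OF bounded_bilinear_inner de[OF t] de[OF t]])
    then have "((\<lambda>t. \<epsilon> t \<bullet> \<epsilon> t) has_real_derivative (2 * (\<epsilon> t \<bullet> ?D))) (at t)"
      by (simp add: has_real_derivative_iff_has_vector_derivative inner_commute)
    moreover have "\<epsilon> t \<bullet> ?D \<le> (L - r * p t) * (\<epsilon> t \<bullet> \<epsilon> t)"
    proof -
      have "\<epsilon> t \<bullet> G t \<le> norm (\<epsilon> t) * (L * norm (\<epsilon> t))"
        using norm_cauchy_schwarz[of "\<epsilon> t" "G t"] mult_left_mono[OF G[OF t], of "norm (\<epsilon> t)"] by simp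
      moreover have "p t * (r * (\<epsilon> t \<bullet> \<epsilon> t)) \<le> p t * (\<epsilon> t \<bullet> (A *v \<epsilon> t))"
        using ray p0 t by (intro mult_left_mono) auto
      ultimately show ?thesis
        by (simp add: inner_simps dot_square_norm power2_eq_square algebra_simps)
    qed
    ultimately show "\<exists>D. ((\<lambda>t. \<epsilon> t \<bullet> \<epsilon> t) has_real_derivative D) (at t) \<and>
        D \<le> (2 * L - 2 * r * p t) * (\<epsilon> t \<bullet> \<epsilon> t)"
      by (intro exI conjI) (assumption, simp add: algebra_simps)
  qed
  also have "integral {a..b} (\<lambda>t. 2 * L - 2 * r * p t) = 2 * (L * (b - a) - r * ?P b)"
    using \<open>a \<le> b\<close> by (subst integral_diff)
      (auto simp: algebra_simps intro!: integrable_continuous_interval continuous_intros p)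
  finally have "(norm (\<epsilon> b))\<^sup>2 \<le> (norm (\<epsilon> a) * exp (L * (b - a) - r * ?P b))\<^sup>2"
    unfolding dot_square_norm power_mult_distrib exp_double .
  then have "norm (\<epsilon> b) \<le> norm (\<epsilon> a) * exp (L * (b - a) - r * ?P b)"
    by (rule power2_le_imp_le) simp
  also have "\<dots> = norm (\<epsilon> a) * exp (L * (b - a)) * exp (- r * ?P b)"
    by (simp flip: exp_add)
  also have "\<dots> \<le> norm (\<epsilon> a) * exp (L * (b - a)) * M powr ?P b"
    by (intro mult_left_mono Pb) simp
  finally show ?thesis .
qed (use M in simp)

context unbounded_time_scale begin

text \<open>At the right end \<open>b\<close> of a dense run an rd-continuous function may jump away from its left
  limit. Replacing the value at \<open>b\<close> by that limit makes it continuous and leaves integrals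
  unchanged.\<close>

lemma continuous_version_on_dense_run:
  fixes \<gamma> :: "real \<Rightarrow> 'a::topological_space"
  assumes rd: "rd_continuous T \<gamma>" and ab: "a \<in> T" "b \<in> T" "a < b"
    and dense: "{s \<in> T. a \<le> s \<and> s < b} \<subseteq> right_dense T"
  obtains g where "continuous_on {a..b} g" "\<And>t. a \<le> t \<Longrightarrow> t < b \<Longrightarrow> g t = \<gamma> t"
proof -
  have sub: "{a..b} \<subseteq> T" using dense_run_interval[OF ab(1,2) dense] .
  have "Sup {s \<in> T. s < b} = b"
  proof (rule cSup_eq_non_empty)
    show "{s \<in> T. s < b} \<noteq> {}" using ab by auto
    show "b \<le> y" if y: "\<And>s. s \<in> {s \<in> T. s < b} \<Longrightarrow> s \<le> y" for y
    proof (rule ccontr)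
      assume "\<not> b \<le> y"
      then have mid: "(y + b) / 2 < b" "y < (y + b) / 2" "a \<le> y" using y[of a] ab by auto
      then have "(y + b) / 2 \<in> {a..b}" by simp
      then show False using y[of "(y + b) / 2"] mid(1,2) sub by (simp add: subset_iff)
    qed
  qed auto
  then have "b \<in> left_dense T" using ab by (auto simp: left_dense_def)
  then obtain l where l: "(\<gamma> \<longlongrightarrow> l) (at b within {s \<in> T. s < b})"
    using rd unfolding rd_continuous_def by blast
  let ?g = "\<lambda>t. if t < b then \<gamma> t else l"
  have "(?g \<longlongrightarrow> ?g t) (at t within {a..b})" if t: "t \<in> {a..b}" for t
  proof (cases "t = b")
    case True
    have "at b within {a..b} = at b within {a..<b}"
      unfolding at_within_def by (intro arg_cong[where f = "\<lambda>S. inf (nhds b) (principal S)"]) auto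
    moreover have "(?g \<longlongrightarrow> l) (at b within {a..<b})"
    proof (rule Lim_transform_within[where d = 1])
      show "(\<gamma> \<longlongrightarrow> l) (at b within {a..<b})"
        by (rule tendsto_within_subset[OF l]) (use sub in auto)
    qed auto
    ultimately show ?thesis using True by simp
  next
    case False
    then have "t \<in> right_dense T" using t sub dense by (simp add: subset_iff)
    then have "(\<gamma> \<longlongrightarrow> \<gamma> t) (at t within {a..b})"
      using rd tendsto_within_subset[OF _ sub] unfolding rd_continuous_def by blast
    then have "(?g \<longlongrightarrow> \<gamma> t) (at t within {a..b})"
      by (rule Lim_transform_within[where d = "b - t"]) (use t False in \<open>auto simp: dist_real_def\<close>)
    then show ?thesis using t False by simp
  qed
  then have "continuous_on {a..b} ?g" by (simp add: continuous_on_def)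
  then show ?thesis by (rule that) simp
qed

text \<open>On a dense run the delta derivative is the classical one, and the estimate for perturbed
  flows applies. It is applied to the continuous version of \<gamma>, since \<gamma> may be
  discontinuous at \<open>b\<close>.\<close>

lemma dense_run_bound:
  fixes A :: "real^'n^'n" and X :: "real \<Rightarrow> real^'n^'n" and \<epsilon> G :: "real \<Rightarrow> real^'n"
  assumes rd: "rd_continuous T \<gamma>" and ab: "a \<in> T" "b \<in> T" "a \<le> b"
    and dense: "{s \<in> T. a \<le> s \<and> s < b} \<subseteq> right_dense T"
    and sym: "transpose A = A"
    and Xa: "X a = mat 1"
    and dX: "\<And>t. t \<in> T \<Longrightarrow> has_delta_derivative T X (- (\<bar>\<gamma> t\<bar> *\<^sub>R A) ** X t) t"
    and de: "\<And>t. t \<in> T \<Longrightarrow> has_delta_derivative T \<epsilon> (G t - \<bar>\<gamma> t\<bar> *\<^sub>R (A *v \<epsilon> t)) t"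
    and G: "\<And>t. t \<in> T \<Longrightarrow> norm (G t) \<le> L * norm (\<epsilon> t)"
    and M: "0 < M"
    and decay: "\<And>t. t \<in> T \<Longrightarrow> a \<le> t \<Longrightarrow> t < b \<Longrightarrow>
      spectral_norm (X t) \<le> M powr integral {a..t} (\<lambda>s. \<bar>\<gamma> s\<bar>)"
  shows "norm (\<epsilon> b) \<le> norm (\<epsilon> a) * exp (L * (b - a)) * M powr integral {a..b} (\<lambda>s. \<bar>\<gamma> s\<bar>)"
proof (cases "a = b")
  case True
  then show ?thesis using M by simp
next
  case False
  then have "a < b" using ab by simp
  have sub: "{a..b} \<subseteq> T" using dense_run_interval[OF ab(1,2) dense] .
  obtain g where g: "continuous_on {a..b} g" and g_eq: "\<And>t. a \<le> t \<Longrightarrow> t < b \<Longrightarrow> g t = \<gamma> t"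
    using continuous_version_on_dense_run[OF rd ab(1,2) \<open>a < b\<close> dense] by blast
  have int: "integral {a..c} (\<lambda>s. \<bar>\<gamma> s\<bar>) = integral {a..c} (\<lambda>s. \<bar>g s\<bar>)" if "c \<le> b" for c
    by (rule integral_spike[of "{b}"]) (use that g_eq in auto)
  have cont: "continuous_on {a..b} f" if "\<And>t. t \<in> T \<Longrightarrow> has_delta_derivative T f (D t) t"
    for f :: "real \<Rightarrow> 'b::real_normed_vector" and D
    unfolding continuous_on_def
    using delta_derivative_imp_continuous[OF that] tendsto_within_subset[OF _ sub] sub by blast
  have der: "(f has_vector_derivative D) (at t)"
    if "has_delta_derivative T f D t" "a < t" "t < b" for f :: "real \<Rightarrow> 'b::real_normed_vector" and D t
  proof -
    have "t \<in> {a..b}" using that by simp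
    then have "t \<in> right_dense T" using that(2,3) sub dense by (simp add: subset_iff)
    moreover have "at t within T = at t"
      by (rule at_within_open_subset[of _ "{a<..<b}"]) (use that(2,3) sub in \<open>simp_all add: subset_iff\<close>)
    ultimately show ?thesis using that(1) by (simp add: delta_derivative_dense_iff)
  qed
  have "norm (\<epsilon> b) \<le> norm (\<epsilon> a) * exp (L * (b - a)) * M powr integral {a..b} (\<lambda>s. \<bar>g s\<bar>)"
  proof (rule perturbed_flow_bound[where X = X and p = "\<lambda>s. \<bar>g s\<bar>" and \<epsilon> = \<epsilon> and G = G,
            OF \<open>a \<le> b\<close> sym _ _ _ Xa _ _ _ _ M])
    show "continuous_on {a..b} (\<lambda>s. \<bar>g s\<bar>)" by (intro continuous_intros g)
    show "continuous_on {a..b} X" by (rule cont[OF dX])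
    show "continuous_on {a..b} \<epsilon>" by (rule cont[OF de])
    fix t assume t: "a < t" "t < b"
    then have "t \<in> T" using sub by auto
    show "(X has_vector_derivative (- (\<bar>g t\<bar> *\<^sub>R A) ** X t)) (at t)"
      using der[OF dX[OF \<open>t \<in> T\<close>] t] t g_eq by simp
    show "(\<epsilon> has_vector_derivative (G t - \<bar>g t\<bar> *\<^sub>R (A *v \<epsilon> t))) (at t)"
      using der[OF de[OF \<open>t \<in> T\<close>] t] t g_eq by simp
    show "norm (G t) \<le> L * norm (\<epsilon> t)" using G \<open>t \<in> T\<close> .
  next
    fix t assume t: "a \<le> t" "t < b"
    show "spectral_norm (X t) \<le> M powr integral {a..t} (\<lambda>s. \<bar>g s\<bar>)"
      using decay[of t] int[of t] t sub by (simp add: subset_iff)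
  qed simp
  then show ?thesis using int[of b] by simp
qed

end

section \<open>Accumulating the estimates over the pieces\<close>

context locally_finite_gaps begin

text \<open>The matrix exponential from \<open>t\<close> to \<open>sigma T t\<close> is the matrix by which the linear part
  of the equation multiplies the error at the jump, and the decay estimate bounds it by a single
  factor \<open>M\<close>. The nonlinearity adds at most \<open>\<mu> * L\<close>.\<close>

lemma jump_bound:
  fixes E :: "real \<Rightarrow> real \<Rightarrow> real^'n^'n" and \<epsilon> :: "real \<Rightarrow> real^'n"
  assumes E: "is_matrix_exponential T A E" and decay: "decay_constant T \<gamma> E M"
    and de: "has_delta_derivative T \<epsilon> (D + A t *v \<epsilon> t) t"
    and D: "norm D \<le> L * norm (\<epsilon> t)" and "0 \<le> L"
    and t: "t \<in> right_scattered T" and mu: "graininess T t \<le> \<mu>"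
  shows "norm (\<epsilon> (sigma T t)) \<le> (M + \<mu> * L) * norm (\<epsilon> t)"
proof -
  have "t \<in> T" "t < sigma T t" using t by (auto simp: right_scattered_def)
  have E1: "E t t = mat 1" and E2: "has_delta_derivative T (\<lambda>r. E r t) (A t ** E t t) t"
    using E \<open>t \<in> T\<close> unfolding is_matrix_exponential_def by blast+
  have E_step: "E (sigma T t) t = mat 1 + graininess T t *\<^sub>R A t"
    using delta_derivative_step[OF E2 \<open>t \<in> T\<close>] E1 by simp
  obtain j where j: "t \<in> piece T j" using pieces_cover[OF \<open>t \<in> T\<close>] .
  have "even j"
    using piece_kind[OF j] t dense_iff_not_scattered[OF \<open>t \<in> T\<close>] by (auto split: if_splits)
  then obtain i where i: "t \<in> piece T (2 * i)" using j by (auto elim: evenE)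
  have "ereal (sigma T t) \<le> switch_point T (2 * i + 1)"
    by (cases rule: switch_point_cases[of "2 * i + 1"])
       (use i sigma_le in \<open>auto simp: piece_def\<close>)
  then have "spectral_norm (E (sigma T t) t) \<le> (\<Prod>r\<in>{r \<in> T. t \<le> r \<and> r < sigma T t}. M)"
    using decay i sigma_in[of t] sigma_ge[of t] unfolding decay_constant_def piece_def by blast
  also have "{r \<in> T. t \<le> r \<and> r < sigma T t} = {t}"
    using sigma_le[of _ t] \<open>t \<in> T\<close> \<open>t < sigma T t\<close> by force
  finally have M: "spectral_norm (E (sigma T t) t) \<le> M" by simp
  have "\<epsilon> (sigma T t) = E (sigma T t) t *v \<epsilon> t + graininess T t *\<^sub>R D"
    using delta_derivative_step[OF de \<open>t \<in> T\<close>] unfolding E_step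
    by (simp add: matrix_vector_mult_add_rdistrib scaleR_right_distrib
        scaleR_matrix_vector_assoc)
  then have "norm (\<epsilon> (sigma T t)) \<le> norm (E (sigma T t) t *v \<epsilon> t) + graininess T t * norm D"
    using norm_triangle_ineq[of "E (sigma T t) t *v \<epsilon> t" "graininess T t *\<^sub>R D"]
      graininess_nonneg[of t] by simp
  also have "\<dots> \<le> M * norm (\<epsilon> t) + \<mu> * (L * norm (\<epsilon> t))"
  proof (rule add_mono)
    show "norm (E (sigma T t) t *v \<epsilon> t) \<le> M * norm (\<epsilon> t)"
      using matrix_vector_bound[of "E (sigma T t) t" "\<epsilon> t"] mult_right_mono[OF M norm_ge_zero[of "\<epsilon> t"]]
      by linarith
    show "graininess T t * norm D \<le> \<mu> * (L * norm (\<epsilon> t))"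
      using mu D graininess_nonneg[of t] by (intro mult_mono) auto
  qed
  finally show ?thesis by (simp add: algebra_simps)
qed

text \<open>A stretch without right-dense points is finite, so its last point before \<open>t\<close> jumps onto
  \<open>t\<close>, and induction over the gaps applies.\<close>

lemma scattered_run_bound:
  fixes n :: "real \<Rightarrow> real"
  assumes a: "a \<in> T" and "0 \<le> K" and jump: "\<And>t. t \<in> right_scattered T \<Longrightarrow> n (sigma T t) \<le> K * n t"
    and start: "n a \<le> C * (\<Prod>s\<in>{s \<in> right_scattered T. s < a}. K)"
    and "t \<in> T" "a \<le> t" "{s \<in> T. a \<le> s \<and> s < t} \<subseteq> right_scattered T"
  shows "n t \<le> C * (\<Prod>s\<in>{s \<in> right_scattered T. s < t}. K)"
  using \<open>t \<in> T\<close> \<open>a \<le> t\<close> \<open>{s \<in> T. a \<le> s \<and> s < t} \<subseteq> right_scattered T\<close>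
proof (induction "card {s \<in> right_scattered T. s < t}" arbitrary: t rule: less_induct)
  case less
  show ?case
  proof (cases "a = t")
    case True
    then show ?thesis using start by simp
  next
    case False
    let ?A = "{s \<in> T. a \<le> s \<and> s < t}"
    have fin: "finite ?A"
      using less.prems(3) finite_gaps[of t] by (rule_tac finite_subset[of _ "{s \<in> right_scattered T. s < t}"]) auto
    have "a \<in> ?A" using False less.prems a by simp
    define p where "p = Max ?A"
    have p: "p \<in> ?A" unfolding p_def using fin \<open>a \<in> ?A\<close> Max_in by blast
    then have ps: "p \<in> right_scattered T" using less.prems by blast
    have "sigma T p \<le> t" using p less.prems sigma_le by auto
    moreover have "\<not> sigma T p < t"
    proof
      assume "sigma T p < t"
      then have "sigma T p \<in> ?A" using sigma_in p sigma_ge[of p] by auto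
      then have "sigma T p \<le> p" unfolding p_def using fin by (rule_tac Max_ge) auto
      then show False using ps by (simp add: right_scattered_def)
    qed
    ultimately have t: "t = sigma T p" by simp
    have gaps: "{s \<in> right_scattered T. s < t} = insert p {s \<in> right_scattered T. s < p}"
      unfolding t by (rule gaps_before_sigma[OF ps])
    have "n p \<le> C * (\<Prod>s\<in>{s \<in> right_scattered T. s < p}. K)"
      by (rule less.hyps) (use p less.prems in \<open>auto simp: gaps card_insert_if finite_gaps\<close>)
    from mult_left_mono[OF this \<open>0 \<le> K\<close>]
    have "K * n p \<le> C * (\<Prod>s\<in>{s \<in> right_scattered T. s < t}. K)"
      by (simp add: gaps finite_gaps mult.left_commute)
    then show ?thesis using jump[OF ps] t by simp
  qed
qed

text \<open>The bounds along runs multiply up. A dense run contributes to the exponential and to the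
  power of \<open>M\<close>, a scattered run to the product. The estimates are proved up to and including
  the right end of each piece, because that is where the next piece starts. The resulting
  majorants have the form of the two functions whose limits are assumed to vanish.\<close>

lemma switched_bound:
  fixes n g :: "real \<Rightarrow> real"
  assumes "0 < M" and "0 \<le> K"
    and jump: "\<And>t. t \<in> right_scattered T \<Longrightarrow> n (sigma T t) \<le> K * n t"
    and flow: "\<And>i a b. switch_point T (2 * i + 1) = ereal a \<Longrightarrow> a \<in> T \<Longrightarrow> b \<in> T \<Longrightarrow> a \<le> b \<Longrightarrow>
      ereal b \<le> switch_point T (2 * i + 2) \<Longrightarrow>
      n b \<le> n a * exp (\<kappa> * (b - a)) * M powr integral {a..b} g"
    and "t \<in> T"
  shows "switch_point T (2 * i) \<le> ereal t \<Longrightarrow> ereal t \<le> switch_point T (2 * i + 1) \<Longrightarrow>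
      n t \<le> n (Inf T) *
        (exp (\<kappa> * (\<Sum>j=1..i. switch_real T (2*j) - switch_real T (2*j - 1)))
         * M powr (\<Sum>j=1..i. integral {switch_real T (2*j - 1)..switch_real T (2*j)} g)
         * (\<Prod>s\<in>{s \<in> right_scattered T. s < t}. K))" (is "?P1 \<Longrightarrow> ?P2 \<Longrightarrow> ?even i t")
    and "switch_point T (2 * i + 1) \<le> ereal t \<Longrightarrow> ereal t \<le> switch_point T (2 * i + 2) \<Longrightarrow>
      n t \<le> n (Inf T) *
        (exp (\<kappa> * ((\<Sum>j=1..i. switch_real T (2*j) - switch_real T (2*j - 1))
                  + (t - switch_real T (2*i + 1))))
         * M powr ((\<Sum>j=1..i. integral {switch_real T (2*j - 1)..switch_real T (2*j)} g)
                   + integral {switch_real T (2*i + 1)..t} g)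
         * (\<Prod>s\<in>{s \<in> right_scattered T. s < switch_real T (2*i + 1)}. K))"
        (is "?P3 \<Longrightarrow> ?P4 \<Longrightarrow> ?odd i t")
proof -
  have run: "?even i t"
    if a: "switch_point T (2 * i) = ereal a" "a \<in> T" "?even i a"
      and t: "t \<in> T" "a \<le> t" "ereal t \<le> switch_point T (2 * i + 1)" for i a t
  proof -
    have "{s \<in> T. a \<le> s \<and> s < t} \<subseteq> right_scattered T"
    proof
      fix s assume s: "s \<in> {s \<in> T. a \<le> s \<and> s < t}"
      then have "ereal s < ereal t" by simp
      also have "ereal t \<le> switch_point T (Suc (2 * i))" using t by simp
      finally have "s \<in> piece T (2 * i)" using s a by (simp add: piece_def)
      then show "s \<in> right_scattered T" using piece_kind[of s "2 * i"] by simp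
    qed
    then show ?thesis
      using scattered_run_bound[of a K n _ t, OF a(2) \<open>0 \<le> K\<close> jump a(3)[folded mult.assoc]] t
      by (simp add: mult.assoc)
  qed
  have odd_step: "?odd i t"
    if even: "\<And>t. t \<in> T \<Longrightarrow> switch_point T (2 * i) \<le> ereal t \<Longrightarrow>
          ereal t \<le> switch_point T (2 * i + 1) \<Longrightarrow> ?even i t"
      and t: "t \<in> T" "switch_point T (2 * i + 1) \<le> ereal t" "ereal t \<le> switch_point T (2 * i + 2)"
    for i t
  proof -
    obtain a where a: "switch_point T (2 * i + 1) = ereal a" "a \<in> T"
      using t(2) by (cases rule: switch_point_cases[of "2 * i + 1"]) auto
    have na: "?even i a"
      by (rule even) (use a switch_point_mono_Suc[of "2 * i"] in simp_all)
    have "n t \<le> n a * (exp (\<kappa> * (t - a)) * M powr integral {a..t} g)"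
      using flow[OF a t(1) _ t(3)] t(2) a by (simp add: mult.assoc)
    also have "\<dots> \<le> n (Inf T) *
        (exp (\<kappa> * (\<Sum>j=1..i. switch_real T (2*j) - switch_real T (2*j - 1)))
         * M powr (\<Sum>j=1..i. integral {switch_real T (2*j - 1)..switch_real T (2*j)} g)
         * (\<Prod>s\<in>{s \<in> right_scattered T. s < a}. K)) * (exp (\<kappa> * (t - a)) * M powr integral {a..t} g)"
      by (rule mult_right_mono[OF na]) simp
    finally show ?thesis
      using a(1) by (simp add: powr_add exp_add distrib_left mult_ac)
  qed
  have even: "?even i t"
    if "t \<in> T" "switch_point T (2 * i) \<le> ereal t" "ereal t \<le> switch_point T (2 * i + 1)" for i t
    using that
  proof (induction i arbitrary: t)
    case 0
    have empty: "{s \<in> right_scattered T. s < Inf T} = {}" using Inf_le scattered_in by force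
    have "?even 0 (Inf T)" unfolding empty using \<open>0 < M\<close> by simp
    then show ?case using 0 run[of 0 "Inf T" t] Inf_in by simp
  next
    case (Suc i)
    obtain b where b: "switch_point T (2 * Suc i) = ereal b" "b \<in> T"
      using Suc.prems(2) by (cases rule: switch_point_cases[of "2 * Suc i"]) auto
    obtain a where a: "switch_point T (2 * i + 1) = ereal a" "a \<in> T"
      using switch_point_mono_Suc[of "2 * i + 1"] b(1)
      by (cases rule: switch_point_cases[of "2 * i + 1"]) auto
    have "a \<le> b" using switch_point_mono_Suc[of "2 * i + 1"] a b by simp
    have "?odd i b"
      by (rule odd_step[OF Suc.IH]) (use a b \<open>a \<le> b\<close> in simp_all)
    moreover have "{s \<in> right_scattered T. s < b} = {s \<in> right_scattered T. s < a}"
    proof -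
      \<comment> \<open>A dense run adds no factor to the product over the gaps.\<close>
      have "s \<notin> right_scattered T" if "s \<in> T" "a \<le> s" "s < b" for s
      proof -
        have "s \<in> piece T (2 * i + 1)" using that a b by (simp add: piece_def)
        then show ?thesis using piece_kind[of s "2 * i + 1"] that dense_iff_not_scattered by simp
      qed
      then show ?thesis using \<open>a \<le> b\<close> scattered_in by force
    qed
    ultimately have "?even (Suc i) b"
      using a(1) b(1) by simp
    then show ?case using run[OF b] Suc.prems b(1) by simp
  qed
  show "?even i t" if ?P1 ?P2 using even that \<open>t \<in> T\<close> by blast
  show "?odd i t" if ?P3 ?P4 using odd_step[OF even] that \<open>t \<in> T\<close> by blast
qed

lemma eventually_small_on_pieces:
  fixes f :: "real \<Rightarrow> real"
  assumes h: "(h \<longlongrightarrow> 0) (at_top_pieces T k)"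
    and bound: "\<And>i t. t \<in> piece T (k i) \<Longrightarrow> f t \<le> c * h (i, t)" and "0 < e"
  obtains R where "\<And>i t. R \<le> t \<Longrightarrow> t \<in> piece T (k i) \<Longrightarrow> f t < e"
proof -
  \<comment> \<open>The constant may be zero or negative, so it is absorbed before passing to absolute values.\<close>
  have "((\<lambda>z. c * h z) \<longlongrightarrow> 0) (at_top_pieces T k)"
    using h by (rule tendsto_mult_right_zero)
  then have "\<forall>\<^sub>F z in at_top_pieces T k. \<bar>c * h z\<bar> < e"
    using tendstoD[OF _ \<open>0 < e\<close>] by fastforce
  then obtain Q where Q: "eventually Q at_top"
    "\<And>z. Q (snd z) \<Longrightarrow> z \<in> {(i, t). t \<in> piece T (k i)} \<Longrightarrow> \<bar>c * h z\<bar> < e"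
    unfolding at_top_pieces_def eventually_inf_principal eventually_filtercomap by blast
  from Q(1) obtain R where "\<And>t. R \<le> t \<Longrightarrow> Q t" unfolding eventually_at_top_linorder by blast
  have "f t < e" if "R \<le> t" "t \<in> piece T (k i)" for i t
  proof -
    have "\<bar>c * h (i, t)\<bar> < e" using Q(2)[of "(i, t)"] \<open>\<And>t. R \<le> t \<Longrightarrow> Q t\<close> that by simp
    then show ?thesis using bound[OF that(2)] by linarith
  qed
  then show ?thesis by (rule that)
qed

end

section \<open>Exponential stability\<close>

theorem theorem1:
  fixes T :: "real set"
    and F :: "real \<Rightarrow> real^'n \<Rightarrow> real^'n"
    and B :: "real^'n^'n"
    and lam :: "'n \<Rightarrow> real"
    and \<gamma> x0 :: "real \<Rightarrow> real"
    and E :: "real \<Rightarrow> real \<Rightarrow> real^'n^'n"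
    and L M \<delta> mustar :: real
  assumes "time_scale T" and "bdd_below T" and "0 \<le> Inf T" and "\<not> bdd_above T"
    and "transpose B = B" and "eigenvalue_list B lam"
    and "rd_continuous T \<gamma>"
    and "\<forall>t\<in>T. invertible (mat 1 - (graininess T t * \<gamma> t) *\<^sub>R B)"
    and "is_matrix_exponential T (\<lambda>t. - (\<gamma> t *\<^sub>R B)) E"
    and "L > 0"
    and "\<forall>t\<in>T. \<forall>x y. norm (F t x - F t y) \<le> L * norm (x - y)"
    and "\<forall>i. \<forall>t\<in>T. 0 < \<gamma> t * lam i"
    and "0 < \<delta>"
    and "\<forall>i. \<forall>t\<in>right_scattered T.
           \<delta> \<le> graininess T t * \<gamma> t * lam i \<and> graininess T t * \<gamma> t * lam i < 1"
    and "decay_constant T \<gamma> E M"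
    and "mustar > 0" and "\<forall>t\<in>T. graininess T t \<le> mustar"
    and "((\<lambda>(i, t).
            exp (L * inverse M * (\<Sum>j=1..i. switch_real T (2*j) - switch_real T (2*j - 1)))
          * M powr (\<Sum>j=1..i. integral {switch_real T (2*j - 1)..switch_real T (2*j)} (\<lambda>s. \<bar>\<gamma> s\<bar>))
          * (\<Prod>s\<in>{s \<in> right_scattered T. s < t}. M + mustar * L)) \<longlongrightarrow> 0)
         (at_top_pieces T (\<lambda>i. 2 * i))"
    and "((\<lambda>(i, t).
            exp (L * inverse M * ((\<Sum>j=1..i. switch_real T (2*j) - switch_real T (2*j - 1))
                                  + (t - switch_real T (2*i + 1))))
          * M powr ((\<Sum>j=1..i. integral {switch_real T (2*j - 1)..switch_real T (2*j)} (\<lambda>s. \<bar>\<gamma> s\<bar>))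
                    + integral {switch_real T (2*i + 1)..t} (\<lambda>s. \<bar>\<gamma> s\<bar>))
          * (\<Prod>s\<in>{s \<in> right_scattered T. s < switch_real T (2*i + 1)}. M + mustar * L)) \<longlongrightarrow> 0)
         (at_top_pieces T (\<lambda>i. 2 * i + 1))"
  shows "exponentially_stable T F \<gamma> B x0"
proof -
  let ?c = "lam undefined"
  interpret unbounded_time_scale T
    using assms(1,2,4) by unfold_locales (auto simp: time_scale_def)
  interpret locally_finite_gaps T
    by unfold_locales (rule finite_right_scattered[OF assms(7,13), of ?c], use assms(14) in blast)
  have M: "0 < M" "M < 1" using assms(15) by (auto simp: decay_constant_def)
  define \<kappa> where "\<kappa> = L * inverse M"
  have "L \<le> \<kappa>" using M \<open>L > 0\<close> by (simp add: \<kappa>_def field_simps)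
  \<comment> \<open>All products \<open>\<gamma> t * lam i\<close> are positive, so \<gamma> has the same constant sign as every
     \<open>lam i\<close>, for instance \<open>?c\<close>; moving this sign into the matrix makes the gain nonnegative.\<close>
  define A where "A = sgn ?c *\<^sub>R B"
  have A: "\<bar>\<gamma> t\<bar> *\<^sub>R A = \<gamma> t *\<^sub>R B" if "t \<in> T" for t
  proof -
    have "0 < \<gamma> t * ?c" using assms(12) that by blast
    then have "\<bar>\<gamma> t\<bar> * sgn ?c = \<gamma> t" by (auto simp: zero_less_mult_iff)
    then show ?thesis by (simp add: A_def)
  qed
  have sym: "transpose A = A" using assms(5) by (simp add: A_def transpose_scalar)
  have stable: "((\<lambda>t. norm (tracking_error x x0 t)) \<longlongrightarrow> 0) (inf at_top (principal T))"
    if "is_solution T F \<gamma> B x0 x" for x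
  proof -
    let ?\<epsilon> = "tracking_error x x0"
    define G where "G t = F t (x t) - F t (x0 t *\<^sub>R 1)" for t
    have G: "norm (G t) \<le> L * norm (?\<epsilon> t)" if "t \<in> T" for t
      using assms(11) that by (simp add: G_def tracking_error_def)
    have de: "has_delta_derivative T ?\<epsilon> (G t - \<gamma> t *\<^sub>R (B *v ?\<epsilon> t)) t" if "t \<in> T" for t
      using \<open>is_solution T F \<gamma> B x0 x\<close> that by (simp add: is_solution_def G_def)
    have jump: "norm (?\<epsilon> (sigma T t)) \<le> (M + mustar * L) * norm (?\<epsilon> t)"
      if t: "t \<in> right_scattered T" for t
    proof (rule jump_bound[OF assms(9,15) _ G _ t])
      have "- (\<gamma> t *\<^sub>R B) *v ?\<epsilon> t = - (\<gamma> t *\<^sub>R (B *v ?\<epsilon> t))"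
        by (simp add: scaleR_matrix_vector_assoc[symmetric] flip: scaleR_minus_left)
      then show "has_delta_derivative T ?\<epsilon> (G t + - (\<gamma> t *\<^sub>R B) *v ?\<epsilon> t) t"
        using de[OF scattered_in[OF t]] by simp
    qed (use t scattered_in assms(10,17) in auto)
    have flow: "norm (?\<epsilon> b) \<le> norm (?\<epsilon> a) * exp (\<kappa> * (b - a)) * M powr integral {a..b} (\<lambda>s. \<bar>\<gamma> s\<bar>)"
      if a: "switch_point T (2 * i + 1) = ereal a" "a \<in> T"
        and b: "b \<in> T" "a \<le> b" "ereal b \<le> switch_point T (2 * i + 2)" for i a b
    proof -
      have piece: "s \<in> piece T (2 * i + 1)" if s: "s \<in> T" "a \<le> s" "s < b" for s
      proof -
        have "ereal s < ereal b" using s by simp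
        also have "\<dots> \<le> switch_point T (Suc (2 * i + 1))" using b by simp
        finally show ?thesis using s a by (simp add: piece_def)
      qed
      have "norm (?\<epsilon> b) \<le> norm (?\<epsilon> a) * exp (L * (b - a)) * M powr integral {a..b} (\<lambda>s. \<bar>\<gamma> s\<bar>)"
      proof (rule dense_run_bound[where X = "\<lambda>t. E t a" and \<epsilon> = ?\<epsilon> and G = G and \<gamma> = \<gamma> and A = A,
            OF assms(7) a(2) b(1,2) _ sym _ _ _ G M(1)])
        show "{s \<in> T. a \<le> s \<and> s < b} \<subseteq> right_dense T"
          using piece piece_kind[of _ "2 * i + 1"] by auto
        show "E a a = mat 1" using assms(9) a(2) by (simp add: is_matrix_exponential_def)
        show "has_delta_derivative T (\<lambda>t. E t a) (- (\<bar>\<gamma> t\<bar> *\<^sub>R A) ** E t a) t" if "t \<in> T" for t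
          using assms(9) a(2) that by (simp add: is_matrix_exponential_def A)
        show "has_delta_derivative T ?\<epsilon> (G t - \<bar>\<gamma> t\<bar> *\<^sub>R (A *v ?\<epsilon> t)) t" if "t \<in> T" for t
          using de[OF that] A[OF that] by (simp add: scaleR_matrix_vector_assoc)
        show "spectral_norm (E t a) \<le> M powr integral {a..t} (\<lambda>s. \<bar>\<gamma> s\<bar>)"
          if "t \<in> T" "a \<le> t" "t < b" for t
        proof -
          have "\<forall>t\<in>piece T (2 * i + 1). spectral_norm (E t (switch_real T (2 * i + 1)))
              \<le> M powr integral {switch_real T (2 * i + 1)..t} (\<lambda>s. \<bar>\<gamma> s\<bar>)"
            using assms(15) unfolding decay_constant_def by blast
          then show ?thesis using piece[OF that] a(1) by simp
        qed
      qed
      also have "\<dots> \<le> norm (?\<epsilon> a) * exp (\<kappa> * (b - a)) * M powr integral {a..b} (\<lambda>s. \<bar>\<gamma> s\<bar>)"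
        using \<open>L \<le> \<kappa>\<close> \<open>a \<le> b\<close>
        by (intro mult_right_mono mult_left_mono) (auto intro: mult_right_mono)
      finally show ?thesis .
    qed
    have K: "0 \<le> M + mustar * L" using M assms(10,16) by simp
    note bounds = switched_bound[where n = "\<lambda>t. norm (?\<epsilon> t)" and g = "\<lambda>s. \<bar>\<gamma> s\<bar>" and \<kappa> = \<kappa>
        and K = "M + mustar * L", OF M(1) K jump flow, unfolded \<kappa>_def]
    show ?thesis
    proof (rule tendstoI)
      fix e :: real assume "e > 0"
      let ?n = "\<lambda>t. norm (?\<epsilon> t)"
      obtain R0 where R0: "\<And>i t. R0 \<le> t \<Longrightarrow> t \<in> piece T (2 * i) \<Longrightarrow> ?n t < e"
      proof (rule eventually_small_on_pieces[OF assms(18) _ \<open>e > 0\<close>, where f = ?n and c = "?n (Inf T)"],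
          goal_cases)
        case (1 i t)
        then show ?case
          unfolding prod.case by (intro bounds(1)) (simp_all add: piece_def order_less_imp_le)
      next
        case (2 R)
        show ?case by (rule 2(1)[OF 2(2)])
      qed
      obtain R1 where R1: "\<And>i t. R1 \<le> t \<Longrightarrow> t \<in> piece T (2 * i + 1) \<Longrightarrow> ?n t < e"
      proof (rule eventually_small_on_pieces[OF assms(19) _ \<open>e > 0\<close>, where f = ?n and c = "?n (Inf T)"],
          goal_cases)
        case (1 i t)
        then show ?case
          unfolding prod.case by (intro bounds(2)) (simp_all add: piece_def order_less_imp_le)
      next
        case (2 R)
        show ?case by (rule 2(1)[OF 2(2)])
      qed
      have "norm (?\<epsilon> t) < e" if "t \<in> T" "max R0 R1 \<le> t" for t
      proof -
        obtain j where j: "t \<in> piece T j" using pieces_cover[OF \<open>t \<in> T\<close>] .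
        show ?thesis
        proof (cases "even j")
          case True
          then show ?thesis using R0 j that by (auto elim!: evenE)
        next
          case False
          then show ?thesis using R1 j that by (auto elim!: oddE)
        qed
      qed
      then show "\<forall>\<^sub>F t in inf at_top (principal T). dist (norm (?\<epsilon> t)) 0 < e"
        unfolding eventually_inf_principal eventually_at_top_linorder
        by (intro exI[of _ "max R0 R1"]) auto
    qed
  qed
  have "\<exists>l. ((\<lambda>t. norm (tracking_error x x0 t)) \<longlongrightarrow> l) (inf at_top (principal T)) \<and>
      l \<le> 1 * norm (tracking_error x x0 (Inf T)) * 0 \<and> 1 * norm (tracking_error x x0 (Inf T)) * 0 = 0"
    if "is_solution T F \<gamma> B x0 x" for x
    using stable[OF that] by (intro exI[of _ 0]) simp
  then show ?thesis
    unfolding exponentially_stable_def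
    using unit_exponential_is_exponential unit_exponential_decay zero_less_one by blast
qed

end
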